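(* Let $S$ be a maximal surface in Lorentz-Minkowski space $\mathbb{L}^3$ whose Gauss map is one-one. Then $S$ has, locally, a Weierstrass-Enneper type representation of the following form. Near each of its points, write $S$ as a graph $(x,y,\varphi(x,y))$ and let $\zeta$ be the associated complex variable (defined in the context). Then $\zeta$ can be used as a local complex parameter on $S$, and there are real constants $x_0,y_0,\varphi_0$ and a meromorphic function $M$ of $\zeta$ (the Weierstrass data) such that $$x(\zeta)=x_{0}+ \Re\left(\int^\zeta M(\omega)(1+\omega^{2})\,d\omega\right),$$ $$y(\zeta)=y_{0}+ \Re\left(\int^\zeta iM(\omega)(1-\omega^{2})\,d\omega\right),$$ $$\varphi(\zeta)=\varphi_{0}+ \Re\left(\int^\zeta 2M(\omega)\,\omega\, d\omega\right).$$
   Context: $\mathbb{L}^3$ denotes $\mathbb{R}^3$ with the Lorentzian metric $dx^2+dy^2-dz^2$ (here the third coordinate of a point of a graph is denoted $\varphi$, and below $z$ denotes the complex number $x+iy$). A spacelike surface is a (smooth) surface in $\mathbb{L}^3$ on which the induced metric is Riemannian. A maximal surface is a spacelike surface whose mean curvature vanishes everywhere. The Gauss map of a spacelike surface assigns to each point the unit (timelike) normal vector at that point, viewed as a point of the spacelike surface $\mathbb{H}^2$ of unit timelike vectors. Every spacelike surface is locally a graph $(x,y,\varphi(x,y))$ of a smooth real function $\varphi$ with $\varphi_x^2+\varphi_y^2<1$; it is maximal if and only if $$(1-\varphi_{x}^2)\varphi_{yy}+2\varphi_{x}\varphi_{y}\varphi_{xy}+(1-\varphi_{y}^2)\varphi_{xx}=0.$$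 The variable $\zeta$: put $z=x+iy$, $u=\varphi_{\bar z}=\tfrac12(\varphi_x+i\varphi_y)$, $v=\varphi_z=\tfrac12(\varphi_x-i\varphi_y)=\bar u$, so $4uv=\varphi_x^2+\varphi_y^2<1$. Then $$\zeta=\frac{1-\sqrt{1-4uv}}{2v},\qquad \bar\zeta=\frac{1-\sqrt{1-4uv}}{2u}$$ (with $\zeta=0$ when $u=v=0$), equivalently $u=\dfrac{\zeta}{1+\zeta\bar\zeta}$, $v=\dfrac{\bar\zeta}{1+\zeta\bar\zeta}$ with $|\zeta|<1$. The integrals $\int^\zeta$ denote primitives in the complex variable. *)

theory Defs
  imports "HOL-Complex_Analysis.Complex_Analysis"
begin

text \<open>
  Lorentz-Minkowski space is \<^typ>\<open>real^3\<close> with the form \<open>mink\<close> below.  The parameter plane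
  \<open>R^2\<close> is \<^typ>\<open>complex\<close>, the pair \<open>(x, y)\<close> being the point \<open>x + iy\<close>.
\<close>

definition mink :: "real^3 \<Rightarrow> real^3 \<Rightarrow> real" where
  "mink a b = a$1 * b$1 + a$2 * b$2 - a$3 * b$3"


subsection \<open>Smooth functions and partial derivatives\<close>

primrec C_k_on :: "nat \<Rightarrow> ('a::euclidean_space \<Rightarrow> 'b::real_normed_vector) \<Rightarrow> 'a set \<Rightarrow> bool" where
  "C_k_on 0 f U \<longleftrightarrow> continuous_on U f"
| "C_k_on (Suc k) f U \<longleftrightarrow>
     (\<forall>x\<in>U. f differentiable (at x)) \<and> (\<forall>h. C_k_on k (\<lambda>x. frechet_derivative f (at x) h) U)"

text \<open>Meant for open \<open>U\<close> only.\<close>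

definition smooth_on :: "('a::euclidean_space \<Rightarrow> 'b::real_normed_vector) \<Rightarrow> 'a set \<Rightarrow> bool" where
  "smooth_on f U \<longleftrightarrow> (\<forall>k. C_k_on k f U)"

definition pdx :: "(complex \<Rightarrow> 'b::real_normed_vector) \<Rightarrow> complex \<Rightarrow> 'b" where
  "pdx f z = frechet_derivative f (at z) 1"

definition pdy :: "(complex \<Rightarrow> 'b::real_normed_vector) \<Rightarrow> complex \<Rightarrow> 'b" where
  "pdy f z = frechet_derivative f (at z) \<i>"


subsection \<open>Maximal surfaces\<close>

text \<open>
  A surface is an abstract topological surface \<open>S\<close> together with a position map \<open>f\<close> into \<open>R^3\<close>
  which is a smooth immersion.  A surface given as a subset \<open>A\<close> of \<open>R^3\<close> is the case
  \<open>S = top_of_set A\<close>, \<open>f = id\<close>.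

  In \<open>local_param S f D c\<close> the map \<open>c\<close> is a homeomorphism of the plane domain \<open>D\<close> onto an open
  part of \<open>S\<close> for which \<open>f \<circ> c\<close> is a smooth immersion.  No compatibility of the parametrizations
  has to be required: immersions are local embeddings, so a continuous change of parameter between
  two smooth immersed parametrizations of the same piece of \<open>S\<close> is a diffeomorphism.
\<close>

definition local_param ::
  "'a topology \<Rightarrow> ('a \<Rightarrow> real^3) \<Rightarrow> complex set \<Rightarrow> (complex \<Rightarrow> 'a) \<Rightarrow> bool" where
  "local_param S f D c \<longleftrightarrow>
     open D \<and> openin S (c ` D) \<and> embedding_map (top_of_set D) S c \<and>
     smooth_on (f \<circ> c) D \<and> (\<forall>w\<in>D. inj (frechet_derivative (f \<circ> c) (at w)))"

definition immersed_surface :: "'a topology \<Rightarrow> ('a \<Rightarrow> real^3) \<Rightarrow> bool" where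
  "immersed_surface S f \<longleftrightarrow>
     Hausdorff_space S \<and> second_countable S \<and>
     (\<forall>p\<in>topspace S. \<exists>D c. local_param S f D c \<and> p \<in> c ` D)"

definition spacelike_surface :: "'a topology \<Rightarrow> ('a \<Rightarrow> real^3) \<Rightarrow> bool" where
  "spacelike_surface S f \<longleftrightarrow> immersed_surface S f \<and>
     (\<forall>D c w h. local_param S f D c \<and> w \<in> D \<and> h \<noteq> 0 \<longrightarrow>
        mink (frechet_derivative (f \<circ> c) (at w) h) (frechet_derivative (f \<circ> c) (at w) h) > 0)"

definition unit_normal :: "(complex \<Rightarrow> real^3) \<Rightarrow> complex \<Rightarrow> real^3 \<Rightarrow> bool" where
  "unit_normal X w n \<longleftrightarrow>
     mink n n = -1 \<and> (\<forall>h. mink n (frechet_derivative X (at w) h) = 0)"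

text \<open>
  Mean curvature at \<open>X w\<close> of the parametrized surface \<open>X\<close> with respect to the unit normal \<open>n\<close>,
  from the coefficients of the first and second fundamental forms.  The overall sign is a
  convention, and it changes with \<open>n\<close>.
\<close>

definition mean_curvature :: "(complex \<Rightarrow> real^3) \<Rightarrow> real^3 \<Rightarrow> complex \<Rightarrow> real" where
  "mean_curvature X n w =
     (let E = mink (pdx X w) (pdx X w);
          F = mink (pdx X w) (pdy X w);
          G = mink (pdy X w) (pdy X w);
          L = mink (pdx (pdx X) w) n;
          M = mink (pdx (pdy X) w) n;
          N = mink (pdy (pdy X) w) n
      in (L * G - 2 * M * F + N * E) / (2 * (E * G - F\<^sup>2)))"

definition maximal_surface :: "'a topology \<Rightarrow> ('a \<Rightarrow> real^3) \<Rightarrow> bool" where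
  "maximal_surface S f \<longleftrightarrow> spacelike_surface S f \<and>
     (\<forall>D c w n. local_param S f D c \<and> w \<in> D \<and> unit_normal (f \<circ> c) w n \<longrightarrow>
        mean_curvature (f \<circ> c) n w = 0)"

text \<open>
  The Gauss map: a continuous field of unit timelike normals.  On a connected surface there are
  exactly two of them, the future directed one and its negative.
\<close>

definition gauss_map :: "'a topology \<Rightarrow> ('a \<Rightarrow> real^3) \<Rightarrow> ('a \<Rightarrow> real^3) \<Rightarrow> bool" where
  "gauss_map S f N \<longleftrightarrow> continuous_map S euclidean N \<and>
     (\<forall>D c w. local_param S f D c \<and> w \<in> D \<longrightarrow> unit_normal (f \<circ> c) w (N (c w)))"


subsection \<open>Graphs and the variable zeta\<close>

text \<open>
  \<open>c\<close> sends \<open>x + iy\<close> to the point of \<open>S\<close> with position \<open>(x, y, \<phi>(x, y))\<close>.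
\<close>

definition local_graph ::
  "'a topology \<Rightarrow> ('a \<Rightarrow> real^3) \<Rightarrow> complex set \<Rightarrow> (complex \<Rightarrow> 'a) \<Rightarrow> (complex \<Rightarrow> real) \<Rightarrow> bool" where
  "local_graph S f D c \<phi> \<longleftrightarrow>
     local_param S f D c \<and> smooth_on \<phi> D \<and>
     (\<forall>z\<in>D. (pdx \<phi> z)\<^sup>2 + (pdy \<phi> z)\<^sup>2 < 1) \<and>
     (\<forall>z\<in>D. f (c z) = vector [Re z, Im z, \<phi> z])"

definition dzbar :: "(complex \<Rightarrow> real) \<Rightarrow> complex \<Rightarrow> complex" where
  "dzbar \<phi> z = (of_real (pdx \<phi> z) + \<i> * of_real (pdy \<phi> z)) / 2"

definition dz :: "(complex \<Rightarrow> real) \<Rightarrow> complex \<Rightarrow> complex" where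
  "dz \<phi> z = (of_real (pdx \<phi> z) - \<i> * of_real (pdy \<phi> z)) / 2"

text \<open>On a spacelike graph the argument of \<^const>\<open>csqrt\<close> is a positive real number.\<close>

definition zeta :: "(complex \<Rightarrow> real) \<Rightarrow> complex \<Rightarrow> complex" where
  "zeta \<phi> z =
     (let u = dzbar \<phi> z; v = dz \<phi> z
      in if v = 0 then 0 else (1 - csqrt (1 - 4 * u * v)) / (2 * v))"

text \<open>
  A complex parameter on a spacelike surface is one for the conformal structure of the induced
  metric, that is, an isothermal one.
\<close>

definition complex_param ::
  "'a topology \<Rightarrow> ('a \<Rightarrow> real^3) \<Rightarrow> complex set \<Rightarrow> (complex \<Rightarrow> 'a) \<Rightarrow> bool" where
  "complex_param S f V P \<longleftrightarrow> local_param S f V P \<and>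
     (\<forall>w\<in>V. mink (pdx (f \<circ> P) w) (pdx (f \<circ> P) w) = mink (pdy (f \<circ> P) w) (pdy (f \<circ> P) w) \<and>
            mink (pdx (f \<circ> P) w) (pdy (f \<circ> P) w) = 0)"

end

theory Submission
  imports Defs
begin

text \<open>
  Write the surface near a point as a spacelike graph \<open>(x, y, \<phi>)\<close>, with slope \<open>p = \<phi>\<^sub>x\<close>, \<open>q = \<phi>\<^sub>y\<close> and
  area density \<open>W = sqrt (1 - p\<^sup>2 - q\<^sup>2)\<close>.  Then \<open>\<zeta> = (p + i q) / (1 + W)\<close>, which is stereographic
  projection of the unit normal.  The maximal surface equation has two consequences.

  First, the one-forms \<open>((1 - p\<^sup>2) dx - p q dy) / W\<close> and \<open>(- p q dx + (1 - q\<^sup>2) dy) / W\<close>, which are up to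
  sign the Hodge duals of \<open>dy\<close> and \<open>dx\<close> for the induced metric, are closed: the coordinate functions of a
  maximal surface are harmonic.  With primitives \<open>F\<close> and \<open>G\<close> the complex function
  \<open>k = (x + F) - i (y + G)\<close> satisfies
  \<open>dk = \<kappa> (d(cnj z) - (cnj \<zeta>)\<^sup>2 dz)\<close>, where \<open>\<kappa> = (1 + W)\<^sup>2 / (2 W)\<close>,
  and it is a local coordinate because \<open>|\<zeta>| < 1\<close>.  The conjugate of the usual coordinate
  \<open>x + F + i (y + G)\<close> appears because, where the slope vanishes, \<open>d\<zeta>\<close> is
  a complex multiple of \<open>d(cnj z)\<close>, not of \<open>dz\<close>.

  Second, \<open>\<zeta>\<close> solves the same Beltrami equation as \<open>k\<close>: \<open>d\<zeta>\<close> is a complex multiple of \<open>dk\<close>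
  (\<open>slope_zeta_beltrami\<close>).  Hence \<open>\<zeta>\<close> is a holomorphic function \<open>\<sigma>\<close> of \<open>k\<close>.  If the Gauss map is injective,
  so is \<open>\<zeta>\<close>, and an injective holomorphic function has nowhere vanishing derivative and a holomorphic
  inverse \<open>j\<close>.  So \<open>\<zeta>\<close> is a coordinate, in which \<open>dk = j' d\<zeta>\<close>.  Put \<open>M = j' / 2\<close>, so \<open>dk = 2 M d\<zeta>\<close>.
  The pointwise identities \<open>slope_zeta_weierstrass_identities\<close> say that
  \<open>dx = Re ((1 + \<zeta>\<^sup>2) dk / 2)\<close>, \<open>dy = Re (i (1 - \<zeta>\<^sup>2) dk / 2)\<close>, \<open>d\<phi> = Re (\<zeta> dk)\<close>,
  and integration over a disc gives the representation (\<open>weierstrass_data_of_graph\<close>).  Here \<open>M\<close> is even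
  holomorphic and nowhere zero.  The three holomorphic coefficients have
  \<open>(1 + \<zeta>\<^sup>2)\<^sup>2 + (i (1 - \<zeta>\<^sup>2))\<^sup>2 - (2 \<zeta>)\<^sup>2 = 0\<close>, so the parametrization by \<open>\<zeta>\<close> is isothermal, and it is smooth
  because its coordinates are real parts of holomorphic functions (\<open>isotropic_curve_immersion\<close>).

  That a spacelike surface is locally a graph at all is the inverse function theorem applied to its
  projection to the \<open>(x, y)\<close> plane, together with the smoothness of the local inverse
  (\<open>smooth_on_compose_local_inverse\<close>).
\<close>

section \<open>Functions of class \<open>C\<^sup>k\<close> and partial derivatives\<close>

lemma C_k_on_Suc_has_derivative:
  "C_k_on (Suc k) f U \<Longrightarrow> x \<in> U \<Longrightarrow> (f has_derivative frechet_derivative f (at x)) (at x)"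
  using frechet_derivative_works by auto

lemma C_k_on_Suc_frechet_derivative:
  "C_k_on (Suc k) f U \<Longrightarrow> C_k_on k (\<lambda>x. frechet_derivative f (at x) h) U"
  by simp

lemma C_k_on_cong:
  assumes "open U" "\<And>x. x \<in> U \<Longrightarrow> f x = g x" "C_k_on k f U"
  shows "C_k_on k g U"
  using assms(2,3)
proof (induction k arbitrary: f g)
  case 0
  then show ?case by (metis C_k_on.simps(1) continuous_on_cong)
next
  case (Suc k)
  have d: "g differentiable (at x)" if xU: "x \<in> U" for x
  proof -
    obtain f' where "(f has_derivative f') (at x)"
      using C_k_on_Suc_has_derivative[OF Suc.prems(2) xU] by blast
    then have "(g has_derivative f') (at x)"
      using has_derivative_transform_within_open[OF _ assms(1) xU] Suc.prems(1) by blast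
    then show ?thesis by (auto simp: differentiable_def)
  qed
  have "frechet_derivative f (at x) h = frechet_derivative g (at x) h" if "x \<in> U" for x h
    using frechet_derivative_transform_within_open[of f x U g] Suc.prems that assms(1) by auto
  then show ?case
    using Suc.prems(2) Suc.IH[of "\<lambda>x. frechet_derivative f (at x) h" "\<lambda>x. frechet_derivative g (at x) h" for h] d by simp
qed

lemma C_k_on_SucD: "C_k_on (Suc k) f U \<Longrightarrow> C_k_on k f U"
proof (induction k arbitrary: f)
  case 0
  then show ?case
    by (auto simp: differentiable_imp_continuous_within intro!: continuous_at_imp_continuous_on)
next
  case (Suc k)
  then have 1: "\<forall>x\<in>U. f differentiable at x"
    and 2: "\<forall>h. C_k_on (Suc k) (\<lambda>x. frechet_derivative f (at x) h) U"
    by (metis C_k_on.simps(2))+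
  have "C_k_on k (\<lambda>x. frechet_derivative f (at x) h) U" for h
    using 2 Suc.IH by blast
  with 1 show ?case by simp
qed

text \<open>
  The clause for \<open>Suc k\<close> in terms of an arbitrary derivative: closure properties of \<open>C\<^sup>k\<close> then follow
  by induction from the usual differentiation rules.
\<close>

lemma C_k_on_SucI:
  assumes "open U" "\<And>x. x \<in> U \<Longrightarrow> (f has_derivative f' x) (at x)"
    and "\<And>h. C_k_on k (\<lambda>x. f' x h) U"
  shows "C_k_on (Suc k) f U"
proof -
  have "C_k_on k (\<lambda>x. frechet_derivative f (at x) h) U" for h
    by (rule C_k_on_cong[OF assms(1) _ assms(3)[of h]]) (simp add: frechet_derivative_at[OF assms(2), symmetric])
  then show ?thesis using assms(2) by (auto simp: differentiable_def)
qed

lemmas C_k_on_SucE = C_k_on_Suc_has_derivative C_k_on_Suc_frechet_derivative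

lemma C_k_on_bounded_linear:
  assumes "open U" "bounded_linear L" "C_k_on k f U"
  shows "C_k_on k (\<lambda>x. L (f x)) U"
  using assms(3)
proof (induction k arbitrary: f)
  case 0
  then show ?case using assms(2) by (auto intro: bounded_linear.continuous_on)
next
  case (Suc k)
  show ?case
    by (rule C_k_on_SucI[OF assms(1), where f' = "\<lambda>x h. L (frechet_derivative f (at x) h)"])
      (use Suc in \<open>auto intro!: C_k_on_SucE bounded_linear.has_derivative[OF assms(2)] simp del: C_k_on.simps\<close>)
qed

lemma C_k_on_const: "C_k_on k (\<lambda>x. c) U"
  by (induction k arbitrary: c) auto

lemma C_k_on_add:
  assumes "open U" "C_k_on k f U" "C_k_on k g U"
  shows "C_k_on k (\<lambda>x. f x + g x) U"
  using assms(2,3)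
proof (induction k arbitrary: f g)
  case 0
  then show ?case by (auto intro: continuous_on_add)
next
  case (Suc k)
  show ?case
    by (rule C_k_on_SucI[OF assms(1), where f' = "\<lambda>x h. frechet_derivative f (at x) h + frechet_derivative g (at x) h"])
      (use Suc in \<open>auto intro!: C_k_on_SucE has_derivative_add simp del: C_k_on.simps\<close>)
qed

lemma C_k_on_mult:
  fixes f g :: "'a::euclidean_space \<Rightarrow> real"
  assumes "open U" "C_k_on k f U" "C_k_on k g U"
  shows "C_k_on k (\<lambda>x. f x * g x) U"
  using assms(2,3)
proof (induction k arbitrary: f g)
  case 0
  then show ?case by (auto intro: continuous_on_mult)
next
  case (Suc k)
  have "C_k_on k f U" "C_k_on k g U" using Suc.prems C_k_on_SucD by blast+
  then show ?case
    by (intro C_k_on_SucI[OF assms(1), where f' = "\<lambda>x h. f x * frechet_derivative g (at x) h + frechet_derivative f (at x) h * g x"])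
      (use Suc in \<open>auto intro!: C_k_on_SucE has_derivative_mult C_k_on_add[OF assms(1)] simp del: C_k_on.simps\<close>)
qed

lemma C_k_on_inverse:
  fixes f :: "'a::euclidean_space \<Rightarrow> real"
  assumes "open U" "C_k_on k f U" "\<And>x. x \<in> U \<Longrightarrow> f x \<noteq> 0"
  shows "C_k_on k (\<lambda>x. inverse (f x)) U"
  using assms(2)
proof (induction k)
  case 0
  then show ?case using assms(3) by (auto intro: continuous_on_inverse)
next
  case (Suc k)
  have i: "C_k_on k (\<lambda>x. inverse (f x)) U" using Suc C_k_on_SucD by blast
  show ?case
  proof (rule C_k_on_SucI[OF assms(1), where f' = "\<lambda>x h. - (inverse (f x) * frechet_derivative f (at x) h * inverse (f x))"])
    show "((\<lambda>x. inverse (f x)) has_derivative (\<lambda>h. - (inverse (f x) * frechet_derivative f (at x) h * inverse (f x)))) (at x)"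
      if "x \<in> U" for x
      using Suc.prems that by (auto intro!: Deriv.has_derivative_inverse C_k_on_Suc_has_derivative assms(3) simp del: C_k_on.simps)
    show "C_k_on k (\<lambda>x. - (inverse (f x) * frechet_derivative f (at x) h * inverse (f x))) U" for h
      using Suc.prems i
      by (intro C_k_on_bounded_linear[OF assms(1) bounded_linear_minus[OF bounded_linear_ident]] C_k_on_mult[OF assms(1)])
        (auto intro!: C_k_on_SucE simp del: C_k_on.simps)
  qed
qed

lemma smooth_on_cong:
  assumes "open U" "\<And>x. x \<in> U \<Longrightarrow> f x = g x" "smooth_on f U"
  shows "smooth_on g U"
  using assms C_k_on_cong unfolding smooth_on_def by blast

lemma C_k_on_subset: "C_k_on k f U \<Longrightarrow> V \<subseteq> U \<Longrightarrow> C_k_on k f V"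
  by (induction k arbitrary: f) (auto intro: continuous_on_subset)

lemma smooth_on_subset: "smooth_on f U \<Longrightarrow> V \<subseteq> U \<Longrightarrow> smooth_on f V"
  unfolding smooth_on_def using C_k_on_subset by blast

lemma smooth_on_bounded_linear:
  "open U \<Longrightarrow> bounded_linear L \<Longrightarrow> smooth_on f U \<Longrightarrow> smooth_on (\<lambda>x. L (f x)) U"
  using C_k_on_bounded_linear unfolding smooth_on_def by blast

lemma smooth_on_add:
  "open U \<Longrightarrow> smooth_on f U \<Longrightarrow> smooth_on g U \<Longrightarrow> smooth_on (\<lambda>x. f x + g x) U"
  using C_k_on_add unfolding smooth_on_def by blast

lemma smooth_on_mult:
  fixes f g :: "'a::euclidean_space \<Rightarrow> real"
  shows "open U \<Longrightarrow> smooth_on f U \<Longrightarrow> smooth_on g U \<Longrightarrow> smooth_on (\<lambda>x. f x * g x) U"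
  using C_k_on_mult unfolding smooth_on_def by blast

lemma smooth_on_inverse:
  fixes f :: "'a::euclidean_space \<Rightarrow> real"
  shows "open U \<Longrightarrow> smooth_on f U \<Longrightarrow> (\<And>x. x \<in> U \<Longrightarrow> f x \<noteq> 0) \<Longrightarrow> smooth_on (\<lambda>x. inverse (f x)) U"
  using C_k_on_inverse unfolding smooth_on_def by blast

lemma smooth_on_const: "smooth_on (\<lambda>x. c) U"
  using C_k_on_const unfolding smooth_on_def by blast

lemma smooth_on_has_derivative:
  assumes "smooth_on f U" "x \<in> U"
  shows "(f has_derivative frechet_derivative f (at x)) (at x)"
  using assms frechet_derivative_works unfolding smooth_on_def by (metis C_k_on.simps(2))

lemma smooth_on_frechet_derivative:
  assumes "smooth_on f U"
  shows "smooth_on (\<lambda>x. frechet_derivative f (at x) h) U"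
  using assms unfolding smooth_on_def by (metis C_k_on.simps(2))

lemma smooth_on_imp_continuous_on: "smooth_on f U \<Longrightarrow> continuous_on U f"
  unfolding smooth_on_def by (metis C_k_on.simps(1))

text \<open>
  A directional derivative of \<open>Re F\<close> is again the real part of a holomorphic function, namely of
  \<open>F' h\<close>, so the induction never leaves this class.
\<close>

lemma C_k_on_Re_holomorphic:
  assumes "open U" "F holomorphic_on U"
  shows "C_k_on k (\<lambda>z. Re (F z)) U"
  using assms(2)
proof (induction k arbitrary: F)
  case 0
  then show ?case by (auto intro: continuous_on_Re holomorphic_on_imp_continuous_on)
next
  case (Suc k)
  show ?case
  proof (rule C_k_on_SucI[OF assms(1), where f' = "\<lambda>z h. Re (deriv F z * h)"])
    show "((\<lambda>z. Re (F z)) has_derivative (\<lambda>h. Re (deriv F x * h))) (at x)" if "x \<in> U" for x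
      using holomorphic_derivI[OF Suc.prems assms(1) that]
      unfolding has_field_derivative_def by (rule has_derivative_Re)
    show "C_k_on k (\<lambda>x. Re (deriv F x * h)) U" for h
      by (rule Suc.IH) (intro holomorphic_intros Suc.prems assms(1))
  qed
qed

lemma smooth_on_Re_holomorphic:
  "open U \<Longrightarrow> F holomorphic_on U \<Longrightarrow> smooth_on (\<lambda>z. Re (F z)) U"
  using C_k_on_Re_holomorphic unfolding smooth_on_def by blast

lemma smooth_on_vector3:
  fixes f g h :: "'a::euclidean_space \<Rightarrow> real"
  assumes "open U" "smooth_on f U" "smooth_on g U" "smooth_on h U"
  shows "smooth_on (\<lambda>x. vector [f x, g x, h x] :: real^3) U"
proof -
  have "smooth_on (\<lambda>x. f x *\<^sub>R axis 1 1 + g x *\<^sub>R axis 2 1 + h x *\<^sub>R axis 3 1 :: real^3) U"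
    by (intro smooth_on_add smooth_on_bounded_linear[OF _ bounded_linear_scaleR_left] assms)
  moreover have "f x *\<^sub>R axis 1 1 + g x *\<^sub>R axis 2 1 + h x *\<^sub>R axis 3 1 = (vector [f x, g x, h x] :: real^3)" for x
    by (simp add: vec_eq_iff forall_3 axis_def)
  ultimately show ?thesis by simp
qed

abbreviation has_grad :: "(complex \<Rightarrow> 'b::real_normed_vector) \<Rightarrow> 'b \<Rightarrow> 'b \<Rightarrow> complex \<Rightarrow> bool" where
  "has_grad f fx fy z \<equiv> (f has_derivative (\<lambda>h. Re h *\<^sub>R fx + Im h *\<^sub>R fy)) (at z)"

lemma has_derivative_pd:
  assumes "f differentiable (at z)"
  shows "has_grad f (pdx f z) (pdy f z) z"
proof -
  have d: "(f has_derivative frechet_derivative f (at z)) (at z)"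
    using assms frechet_derivative_works by blast
  then interpret linear "frechet_derivative f (at z)" by (rule has_derivative_linear)
  have "frechet_derivative f (at z) h = Re h *\<^sub>R pdx f z + Im h *\<^sub>R pdy f z" for h
  proof -
    have "h = Re h *\<^sub>R 1 + Im h *\<^sub>R \<i>" by (simp add: complex_eq_iff)
    then have "frechet_derivative f (at z) h = frechet_derivative f (at z) (Re h *\<^sub>R 1 + Im h *\<^sub>R \<i>)" by simp
    then show ?thesis by (simp only: add scale pdx_def pdy_def)
  qed
  then show ?thesis using d by (metis (no_types, lifting) has_derivative_eq_rhs ext)
qed

lemma pdx_eqI: "(f has_derivative f') (at z) \<Longrightarrow> pdx f z = f' 1"
  unfolding pdx_def by (metis frechet_derivative_at)

lemma pdy_eqI: "(f has_derivative f') (at z) \<Longrightarrow> pdy f z = f' \<i>"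
  unfolding pdy_def by (metis frechet_derivative_at)

lemma smooth_on_pd: assumes "smooth_on f U" shows "smooth_on (pdx f) U" "smooth_on (pdy f) U"
  using smooth_on_frechet_derivative[OF assms, of 1] smooth_on_frechet_derivative[OF assms, of \<i>]
  by (simp_all add: pdx_def[abs_def] pdy_def[abs_def])

lemma smooth_on_has_derivative_pd:
  assumes "smooth_on f U" "z \<in> U"
  shows "has_grad f (pdx f z) (pdy f z) z"
  using has_derivative_pd smooth_on_has_derivative[OF assms] differentiableI by blast

section \<open>Symmetry of mixed partials, local inverses and closed one-forms\<close>

text \<open>
  Apply the mean value theorem first in direction \<open>a\<close>, to the difference of \<open>f\<close> over a step in
  direction \<open>b\<close>, and then in direction \<open>b\<close>.
\<close>

lemma second_difference_mean_value:
  fixes f :: "'a::real_normed_vector \<Rightarrow> real"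
  assumes "t > 0"
    and f: "\<And>x y. 0 \<le> x \<Longrightarrow> x \<le> t \<Longrightarrow> 0 \<le> y \<Longrightarrow> y \<le> t \<Longrightarrow>
      (f has_derivative f' (z + x *\<^sub>R a + y *\<^sub>R b)) (at (z + x *\<^sub>R a + y *\<^sub>R b))"
    and g: "\<And>x y. 0 \<le> x \<Longrightarrow> x \<le> t \<Longrightarrow> 0 \<le> y \<Longrightarrow> y \<le> t \<Longrightarrow>
      ((\<lambda>w. f' w a) has_derivative g' (z + x *\<^sub>R a + y *\<^sub>R b)) (at (z + x *\<^sub>R a + y *\<^sub>R b))"
  obtains \<xi> \<eta> where "0 < \<xi>" "\<xi> < t" "0 < \<eta>" "\<eta> < t"
    "f (z + t *\<^sub>R a + t *\<^sub>R b) - f (z + t *\<^sub>R a) - f (z + t *\<^sub>R b) + f z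
       = t * (t * g' (z + \<xi> *\<^sub>R a + \<eta> *\<^sub>R b) b)"
proof -
  have D: "((\<lambda>x. F (l x)) has_real_derivative F' c) (at x)"
    if "(F has_derivative F') (at (l x))" "(l has_derivative (\<lambda>h. h *\<^sub>R c)) (at x)"
    for F F' and l :: "real \<Rightarrow> 'a" and c x
  proof -
    interpret linear F' using that(1) by (rule has_derivative_linear)
    show ?thesis
      unfolding has_field_derivative_def
      by (rule has_derivative_eq_rhs[OF has_derivative_compose[OF that(2,1)]]) (simp add: scale fun_eq_iff)
  qed
  have lin1: "((\<lambda>x. z + x *\<^sub>R a + y *\<^sub>R b) has_derivative (\<lambda>h. h *\<^sub>R a)) (at x)" for x y
    by (auto intro!: derivative_eq_intros)
  have lin2: "((\<lambda>y. z + x *\<^sub>R a + y *\<^sub>R b) has_derivative (\<lambda>h. h *\<^sub>R b)) (at y)" for x y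
    by (auto intro!: derivative_eq_intros)
  have "\<exists>\<xi>. 0 < \<xi> \<and> \<xi> < t \<and>
      (f (z + t *\<^sub>R a + t *\<^sub>R b) - f (z + t *\<^sub>R a + 0 *\<^sub>R b)) - (f (z + 0 *\<^sub>R a + t *\<^sub>R b) - f (z + 0 *\<^sub>R a + 0 *\<^sub>R b))
      = (t - 0) * (f' (z + \<xi> *\<^sub>R a + t *\<^sub>R b) a - f' (z + \<xi> *\<^sub>R a + 0 *\<^sub>R b) a)"
  proof (rule MVT2[OF assms(1), of "\<lambda>x. f (z + x *\<^sub>R a + t *\<^sub>R b) - f (z + x *\<^sub>R a + 0 *\<^sub>R b)"
        "\<lambda>x. f' (z + x *\<^sub>R a + t *\<^sub>R b) a - f' (z + x *\<^sub>R a + 0 *\<^sub>R b) a"])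
    fix x assume x: "0 \<le> x" "x \<le> t"
    show "((\<lambda>x. f (z + x *\<^sub>R a + t *\<^sub>R b) - f (z + x *\<^sub>R a + 0 *\<^sub>R b)) has_real_derivative
        f' (z + x *\<^sub>R a + t *\<^sub>R b) a - f' (z + x *\<^sub>R a + 0 *\<^sub>R b) a) (at x)"
      using x assms(1)
      by (intro DERIV_diff D[where F = f and l = "\<lambda>x. z + x *\<^sub>R a + _ *\<^sub>R b", OF f lin1]) auto
  qed
  then obtain \<xi> where \<xi>: "0 < \<xi>" "\<xi> < t" and 1:
      "(f (z + t *\<^sub>R a + t *\<^sub>R b) - f (z + t *\<^sub>R a + 0 *\<^sub>R b)) - (f (z + 0 *\<^sub>R a + t *\<^sub>R b) - f (z + 0 *\<^sub>R a + 0 *\<^sub>R b))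
      = (t - 0) * (f' (z + \<xi> *\<^sub>R a + t *\<^sub>R b) a - f' (z + \<xi> *\<^sub>R a + 0 *\<^sub>R b) a)" by blast
  have "\<exists>\<eta>. 0 < \<eta> \<and> \<eta> < t \<and>
      f' (z + \<xi> *\<^sub>R a + t *\<^sub>R b) a - f' (z + \<xi> *\<^sub>R a + 0 *\<^sub>R b) a = (t - 0) * g' (z + \<xi> *\<^sub>R a + \<eta> *\<^sub>R b) b"
  proof (rule MVT2[OF assms(1), of "\<lambda>y. f' (z + \<xi> *\<^sub>R a + y *\<^sub>R b) a" "\<lambda>y. g' (z + \<xi> *\<^sub>R a + y *\<^sub>R b) b"])
    fix y assume y: "0 \<le> y" "y \<le> t"
    show "((\<lambda>y. f' (z + \<xi> *\<^sub>R a + y *\<^sub>R b) a) has_real_derivative g' (z + \<xi> *\<^sub>R a + y *\<^sub>R b) b) (at y)"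
      using D[where F = "\<lambda>w. f' w a" and l = "\<lambda>y. z + \<xi> *\<^sub>R a + y *\<^sub>R b", OF g lin2] \<xi> y by auto
  qed
  then obtain \<eta> where \<eta>: "0 < \<eta>" "\<eta> < t" and 2:
      "f' (z + \<xi> *\<^sub>R a + t *\<^sub>R b) a - f' (z + \<xi> *\<^sub>R a + 0 *\<^sub>R b) a = (t - 0) * g' (z + \<xi> *\<^sub>R a + \<eta> *\<^sub>R b) b"
    by blast
  show ?thesis
  proof (rule that[OF \<xi> \<eta>])
    show "f (z + t *\<^sub>R a + t *\<^sub>R b) - f (z + t *\<^sub>R a) - f (z + t *\<^sub>R b) + f z
       = t * (t * g' (z + \<xi> *\<^sub>R a + \<eta> *\<^sub>R b) b)"
      using 1 unfolding 2 by simp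
  qed
qed

text \<open>
  Schwarz's theorem.  The second difference of \<open>f\<close> over a small parallelogram is symmetric in the two
  directions, and the mean value form turns it into either mixed derivative at a nearby point.
\<close>

lemma mixed_partials_symmetric:
  fixes f :: "'a::real_normed_vector \<Rightarrow> real"
  assumes "open D" "z \<in> D"
    and f: "\<And>w. w \<in> D \<Longrightarrow> (f has_derivative f' w) (at w)"
    and g: "\<And>w. w \<in> D \<Longrightarrow> ((\<lambda>w. f' w a) has_derivative g' w) (at w)"
    and k: "\<And>w. w \<in> D \<Longrightarrow> ((\<lambda>w. f' w b) has_derivative k' w) (at w)"
    and cont: "continuous_on D (\<lambda>w. g' w b)" "continuous_on D (\<lambda>w. k' w a)"
  shows "g' z b = k' z a"
proof (rule ccontr)
  assume ne: "g' z b \<noteq> k' z a"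
  define e where "e = \<bar>g' z b - k' z a\<bar> / 2"
  have "e > 0" using ne by (simp add: e_def)
  have "isCont (\<lambda>w. g' w b) z" "isCont (\<lambda>w. k' w a) z"
    using cont assms(1,2) continuous_on_eq_continuous_at by blast+
  then obtain d1 d2 where d1: "d1 > 0" "\<And>w. dist w z < d1 \<Longrightarrow> dist (g' w b) (g' z b) < e"
    and d2: "d2 > 0" "\<And>w. dist w z < d2 \<Longrightarrow> dist (k' w a) (k' z a) < e"
    using \<open>e > 0\<close> unfolding continuous_at_eps_delta by metis
  obtain d3 where d3: "d3 > 0" "ball z d3 \<subseteq> D" using assms(1,2) openE by blast
  define d where "d = min d1 (min d2 d3)"
  define t where "t = d / (2 * (norm a + norm b + 1))"
  have "d > 0" using d1 d2 d3 by (simp add: d_def)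
  \<comment> \<open>The summand 1 only keeps the denominator in the definition of \<open>t\<close> positive.\<close>
  have pos: "norm a + norm b + 1 > 0" by (smt (verit) norm_ge_zero)
  then have t: "t > 0" using \<open>d > 0\<close> by (simp add: t_def)
  have near: "dist (z + x *\<^sub>R a + y *\<^sub>R b) z < d" if "0 \<le> x" "x \<le> t" "0 \<le> y" "y \<le> t" for x y
  proof -
    have "dist (z + x *\<^sub>R a + y *\<^sub>R b) z = norm (x *\<^sub>R a + y *\<^sub>R b)" by (simp add: dist_norm algebra_simps)
    also have "\<dots> \<le> x * norm a + y * norm b"
      using norm_triangle_ineq[of "x *\<^sub>R a" "y *\<^sub>R b"] that by simp
    also have "\<dots> \<le> t * norm a + t * norm b" using that by (intro add_mono mult_right_mono) auto
    also have "\<dots> \<le> t * (norm a + norm b + 1)" using t by (simp add: algebra_simps)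
    also have "\<dots> = d / 2" using pos unfolding t_def by (simp add: field_simps)
    finally show ?thesis using \<open>d > 0\<close> by simp
  qed
  have inD: "z + x *\<^sub>R a + y *\<^sub>R b \<in> D" if "0 \<le> x" "x \<le> t" "0 \<le> y" "y \<le> t" for x y
    using near[OF that] d3 by (auto simp: d_def dist_commute subset_iff)
  obtain \<xi> \<eta> where 1: "0 < \<xi>" "\<xi> < t" "0 < \<eta>" "\<eta> < t"
    and e1: "f (z + t *\<^sub>R a + t *\<^sub>R b) - f (z + t *\<^sub>R a) - f (z + t *\<^sub>R b) + f z
       = t * (t * g' (z + \<xi> *\<^sub>R a + \<eta> *\<^sub>R b) b)"
    by (rule second_difference_mean_value[OF t, of f f' z a b g']) (auto intro: f g inD)
  have swap: "z + x *\<^sub>R b + y *\<^sub>R a = z + y *\<^sub>R a + x *\<^sub>R b" for x y by (simp only: add_ac)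
  obtain \<xi>' \<eta>' where 2: "0 < \<xi>'" "\<xi>' < t" "0 < \<eta>'" "\<eta>' < t"
    and e2: "f (z + t *\<^sub>R b + t *\<^sub>R a) - f (z + t *\<^sub>R b) - f (z + t *\<^sub>R a) + f z
       = t * (t * k' (z + \<xi>' *\<^sub>R b + \<eta>' *\<^sub>R a) a)"
    by (rule second_difference_mean_value[OF t, of f f' z b a k']) (auto simp: swap intro: f k inD)
  have "t * (t * g' (z + \<xi> *\<^sub>R a + \<eta> *\<^sub>R b) b) = t * (t * k' (z + \<eta>' *\<^sub>R a + \<xi>' *\<^sub>R b) a)"
    using e1 e2 unfolding swap by linarith
  then have "g' (z + \<xi> *\<^sub>R a + \<eta> *\<^sub>R b) b = k' (z + \<eta>' *\<^sub>R a + \<xi>' *\<^sub>R b) a"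
    using t by simp
  moreover have "dist (g' (z + \<xi> *\<^sub>R a + \<eta> *\<^sub>R b) b) (g' z b) < e"
    using near[of \<xi> \<eta>] 1 by (intro d1) (auto simp: d_def)
  moreover have "dist (k' (z + \<eta>' *\<^sub>R a + \<xi>' *\<^sub>R b) a) (k' z a) < e"
    using near[of \<eta>' \<xi>'] 2 by (intro d2) (auto simp: d_def)
  ultimately show False unfolding e_def dist_real_def by (smt (verit) field_sum_of_halves)
qed

lemma bounded_linear_plane: "bounded_linear (\<lambda>h. Re h *\<^sub>R a + Im h *\<^sub>R b)"
  by (intro bounded_linear_add bounded_linear_compose[OF bounded_linear_scaleR_left]
      bounded_linear_Re bounded_linear_Im)

definition plane_blinfun :: "'b::real_normed_vector \<Rightarrow> 'b \<Rightarrow> complex \<Rightarrow>\<^sub>L 'b" where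
  "plane_blinfun a b = Blinfun (\<lambda>h. Re h *\<^sub>R a + Im h *\<^sub>R b)"

lemma plane_blinfun_apply [simp]: "blinfun_apply (plane_blinfun a b) = (\<lambda>h. Re h *\<^sub>R a + Im h *\<^sub>R b)"
  unfolding plane_blinfun_def by (rule bounded_linear_Blinfun_apply[OF bounded_linear_plane])

lemma continuous_on_plane_blinfun:
  fixes S :: "'a::t2_space set"
  shows "continuous_on S a \<Longrightarrow> continuous_on S b \<Longrightarrow> continuous_on S (\<lambda>x. plane_blinfun (a x) (b x))"
  by (rule continuous_on_blinfun_componentwise) (auto simp: Basis_complex_def)

text \<open>
  The inverse function theorem in the plane with the derivative written through its two partials,
  so that neither bounded linear operators nor their inverses occur in the statement.
\<close>

lemma plane_inverse_function:
  fixes f a b :: "complex \<Rightarrow> complex"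
  assumes "open U" "x0 \<in> U"
    and der: "\<And>x. x \<in> U \<Longrightarrow> has_grad f (a x) (b x) x"
    and cont: "continuous_on U a" "continuous_on U b"
    and inj: "\<And>h. Re h *\<^sub>R a x0 + Im h *\<^sub>R b x0 = 0 \<Longrightarrow> h = 0"
  obtains U' V g g' where "open U'" "U' \<subseteq> U" "x0 \<in> U'" "open V" "homeomorphism U' V f g"
    "\<And>y. y \<in> V \<Longrightarrow> (g has_derivative g' y) (at y)"
    "\<And>y h. y \<in> V \<Longrightarrow> Re (g' y h) *\<^sub>R a (g y) + Im (g' y h) *\<^sub>R b (g y) = h"
proof -
  define f' where "f' = (\<lambda>x. plane_blinfun (a x) (b x))"
  have lin: "linear (blinfun_apply (f' x0))"
    by (rule bounded_linear.linear[OF blinfun.bounded_linear_right])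
  have "inj (blinfun_apply (f' x0))"
    unfolding linear_injective_0[OF lin] unfolding f'_def plane_blinfun_apply using inj by blast
  then obtain L where L: "linear L" "L \<circ> blinfun_apply (f' x0) = id"
    using linear_injective_left_inverse[OF lin] by blast
  have "Blinfun L o\<^sub>L f' x0 = id_blinfun"
    using L by (intro blinfun_eqI) (simp add: bounded_linear_Blinfun_apply linear_conv_bounded_linear o_def fun_eq_iff del: plane_blinfun_apply)
  moreover have "(f has_derivative blinfun_apply (f' x)) (at x)" if "x \<in> U" for x
    using der[OF that] by (simp add: f'_def)
  moreover have "continuous_on U f'"
    unfolding f'_def by (rule continuous_on_plane_blinfun[OF cont])
  ultimately obtain U' V g g' where g: "open U'" "U' \<subseteq> U" "x0 \<in> U'" "open V" "f x0 \<in> V" "homeomorphism U' V f g"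
    "\<And>y. y \<in> V \<Longrightarrow> (g has_derivative (g' y)) (at y)"
    "\<And>y. y \<in> V \<Longrightarrow> g' y = inv (blinfun_apply (f'(g y)))"
    "\<And>y. y \<in> V \<Longrightarrow> bij (blinfun_apply (f'(g y)))"
    using inverse_function_theorem[OF assms(1), of f f' x0] assms(2) by metis
  have "Re (g' y h) *\<^sub>R a (g y) + Im (g' y h) *\<^sub>R b (g y) = h" if "y \<in> V" for y h
  proof -
    have "blinfun_apply (f' (g y)) (g' y h) = h"
      using g(8,9)[OF that] by (simp add: bij_is_surj surj_f_inv_f)
    then show ?thesis by (simp add: f'_def)
  qed
  with g that show ?thesis by blast
qed

text \<open>
  The Poincare lemma.  Integrate the form along segments from a base point and differentiate under
  the integral sign; closedness (the shared partial \<open>c\<close>) makes the integrand of the derivative in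
  direction \<open>h\<close> equal to \<open>d/dt (t \<omega>(h))\<close>, with \<open>\<omega>\<close> taken at the point with parameter \<open>t\<close>.
\<close>

lemma closed_form_has_primitive:
  fixes a b :: "complex \<Rightarrow> 'b::banach"
  assumes "open D" "convex D"
    and a: "\<And>z. z \<in> D \<Longrightarrow> has_grad a (ax z) (c z) z"
    and b: "\<And>z. z \<in> D \<Longrightarrow> has_grad b (c z) (bz z) z"
    and cont: "continuous_on D ax" "continuous_on D c" "continuous_on D bz"
  obtains k where "\<And>z. z \<in> D \<Longrightarrow> has_grad k (a z) (b z) z"
proof (cases "D = {}")
  case False
  then obtain z0 where z0: "z0 \<in> D" by blast
  define l where "l = (\<lambda>x t. z0 + t *\<^sub>R (x - z0))"
  have l: "l x t \<in> D" if "x \<in> D" "t \<in> {0..1}" for x t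
  proof -
    have "l x t = (1 - t) *\<^sub>R z0 + t *\<^sub>R x" by (simp add: l_def algebra_simps)
    then show ?thesis using convexD[OF assms(2) z0 that(1), of "1 - t" t] that by simp
  qed
  \<comment> \<open>The pullback of the form to the segment from \<open>z0\<close> to \<open>x\<close>; \<open>P\<close> and \<open>Q\<close> are its partials in \<open>x\<close>.\<close>
  define f where "f = (\<lambda>x t. Re (x - z0) *\<^sub>R a (l x t) + Im (x - z0) *\<^sub>R b (l x t))"
  define P where "P = (\<lambda>x t. a (l x t) + t *\<^sub>R (Re (x - z0) *\<^sub>R ax (l x t) + Im (x - z0) *\<^sub>R c (l x t)))"
  define Q where "Q = (\<lambda>x t. b (l x t) + t *\<^sub>R (Re (x - z0) *\<^sub>R c (l x t) + Im (x - z0) *\<^sub>R bz (l x t)))"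
  have contab: "continuous_on D a" "continuous_on D b"
    using a b by (meson continuous_at_imp_continuous_on has_derivative_continuous)+
  have contl: "continuous_on (D \<times> {0..1}) (\<lambda>p. F (l (fst p) (snd p)))"
    if "continuous_on D F" for F :: "complex \<Rightarrow> 'b"
  proof (rule continuous_on_compose2[OF that])
    show "continuous_on (D \<times> {0..1}) (\<lambda>p. l (fst p) (snd p))"
      unfolding l_def by (intro continuous_intros)
  qed (auto intro!: l)
  have contl1: "continuous_on {0..1} (\<lambda>t. F (l x t))" if "continuous_on D F" "x \<in> D" for F :: "complex \<Rightarrow> 'b" and x
    by (rule continuous_on_compose2[OF that(1), of _ "l x"])
      (use l[OF that(2)] in \<open>auto intro!: continuous_intros simp: l_def\<close>)
  have lx: "((\<lambda>x. l x t) has_derivative (\<lambda>h. t *\<^sub>R h)) (at x within S)" for t x S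
    unfolding l_def by (auto intro!: derivative_eq_intros)
  have lt: "(l x has_derivative (\<lambda>s. s *\<^sub>R (x - z0))) (at t within S)" for t x S
    unfolding l_def by (auto intro!: derivative_eq_intros)
  have leib: "((\<lambda>x. integral (cbox 0 1) (f x)) has_derivative
      integral (cbox 0 1) (\<lambda>t. plane_blinfun (P x t) (Q x t))) (at x within D)" if x: "x \<in> D" for x
  proof (rule leibniz_rule[OF _ _ _ x assms(2)])
    fix y and t :: real assume y: "y \<in> D" and t: "t \<in> cbox 0 1"
    have ly: "l y t \<in> D" using l y t by auto
    show "((\<lambda>x. f x t) has_derivative blinfun_apply (plane_blinfun (P y t) (Q y t))) (at y within D)"
      unfolding f_def plane_blinfun_apply
      by (rule derivative_eq_intros has_derivative_compose[OF lx a[OF ly]]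
          has_derivative_compose[OF lx b[OF ly]] refl)+
        (simp add: P_def Q_def algebra_simps scaleR_add_right)
  next
    fix y assume y: "y \<in> D"
    show "f y integrable_on cbox 0 1"
      unfolding f_def box_real by (intro integrable_continuous_real continuous_intros contl1 contab y)
  next
    show "continuous_on (D \<times> cbox 0 1) (\<lambda>(x, t). plane_blinfun (P x t) (Q x t))"
      unfolding split_beta' P_def Q_def box_real
      by (intro continuous_on_plane_blinfun continuous_intros contl contab cont)
  qed
  have int: "blinfun_apply (integral (cbox 0 1) (\<lambda>t. plane_blinfun (P x t) (Q x t))) h = Re h *\<^sub>R a x + Im h *\<^sub>R b x"
    if x: "x \<in> D" for x h
  proof -
    have "(\<lambda>t. plane_blinfun (P x t) (Q x t)) integrable_on cbox 0 1"
      unfolding P_def Q_def box_real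
      by (intro integrable_continuous_real continuous_on_plane_blinfun continuous_intros contl1 contab cont x)
    then have "blinfun_apply (integral (cbox 0 1) (\<lambda>t. plane_blinfun (P x t) (Q x t))) h
        = integral (cbox 0 1) (\<lambda>t. Re h *\<^sub>R P x t + Im h *\<^sub>R Q x t)"
      by (subst blinfun_apply_integral) auto
    also have "\<dots> = 1 *\<^sub>R (Re h *\<^sub>R a (l x 1) + Im h *\<^sub>R b (l x 1)) - 0 *\<^sub>R (Re h *\<^sub>R a (l x 0) + Im h *\<^sub>R b (l x 0))"
      unfolding box_real
    proof (rule integral_unique, rule fundamental_theorem_of_calculus)
      fix t :: real assume t: "t \<in> {0..1}"
      show "((\<lambda>t. t *\<^sub>R (Re h *\<^sub>R a (l x t) + Im h *\<^sub>R b (l x t))) has_vector_derivative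
          Re h *\<^sub>R P x t + Im h *\<^sub>R Q x t) (at t within {0..1})"
        unfolding has_vector_derivative_def
        by (rule derivative_eq_intros has_derivative_compose[OF lt a[OF l[OF x t]]]
          has_derivative_compose[OF lt b[OF l[OF x t]]] refl)+
        (simp add: P_def Q_def algebra_simps scaleR_add_right)
    qed simp
    finally show ?thesis by (simp add: l_def)
  qed
  show ?thesis
  proof (rule that)
    fix x assume x: "x \<in> D"
    show "((\<lambda>x. integral (cbox 0 1) (f x)) has_derivative (\<lambda>h. Re h *\<^sub>R a x + Im h *\<^sub>R b x)) (at x)"
      using leib[OF x] unfolding at_within_open[OF x assms(1)] int[OF x, abs_def] .
  qed
qed (use that in blast)

section \<open>The slope, zeta and the conjugate isothermal one-form\<close>

lemma has_grad_mult:
  fixes f g :: "complex \<Rightarrow> real"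
  assumes "has_grad f fx fy z" "has_grad g gx gy z"
  shows "has_grad (\<lambda>z. f z * g z) (fx * g z + f z * gx) (fy * g z + f z * gy) z"
  by (rule has_derivative_eq_rhs[OF has_derivative_mult[OF assms]]) (simp add: algebra_simps)

lemma has_grad_add:
  fixes f g :: "complex \<Rightarrow> real"
  assumes "has_grad f fx fy z" "has_grad g gx gy z"
  shows "has_grad (\<lambda>z. f z + g z) (fx + gx) (fy + gy) z"
  by (rule has_derivative_eq_rhs[OF has_derivative_add[OF assms]]) (simp add: algebra_simps)

lemma has_grad_minus:
  fixes f :: "complex \<Rightarrow> real"
  assumes "has_grad f fx fy z"
  shows "has_grad (\<lambda>z. - f z) (- fx) (- fy) z"
  by (rule has_derivative_eq_rhs[OF has_derivative_minus[OF assms]]) (simp add: algebra_simps)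

lemma has_grad_const: "has_grad (\<lambda>z. c) 0 0 z"
  by simp

lemma has_grad_divide:
  fixes f g :: "complex \<Rightarrow> real"
  assumes "has_grad f fx fy z" "has_grad g gx gy z" "g z \<noteq> 0"
  shows "has_grad (\<lambda>z. f z / g z) ((fx * g z - f z * gx) / (g z)\<^sup>2) ((fy * g z - f z * gy) / (g z)\<^sup>2) z"
proof (rule has_derivative_eq_rhs[OF has_derivative_divide'[OF assms]], rule ext)
  fix h
  show "((Re h *\<^sub>R fx + Im h *\<^sub>R fy) * g z - f z * (Re h *\<^sub>R gx + Im h *\<^sub>R gy)) / (g z * g z) =
    Re h *\<^sub>R ((fx * g z - f z * gx) / (g z)\<^sup>2) + Im h *\<^sub>R ((fy * g z - f z * gy) / (g z)\<^sup>2)"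
    by (simp add: power2_eq_square add_divide_distrib[symmetric] algebra_simps)
qed

lemma has_grad_Complex:
  assumes "has_grad f fx fy z" "has_grad g gx gy z"
  shows "has_grad (\<lambda>z. Complex (f z) (g z)) (Complex fx gx) (Complex fy gy) z"
proof -
  have "((\<lambda>z. of_real (f z) + \<i> * of_real (g z)) has_derivative
     (\<lambda>h. of_real (Re h *\<^sub>R fx + Im h *\<^sub>R fy) + \<i> * of_real (Re h *\<^sub>R gx + Im h *\<^sub>R gy))) (at z)"
    using assms by (intro has_derivative_add has_derivative_mult_right has_derivative_of_real) auto
  then show ?thesis
    by (auto simp: Complex_eq scaleR_conv_of_real algebra_simps elim!: has_derivative_eq_rhs)
qed

definition area_density :: "real \<Rightarrow> real \<Rightarrow> real" where
  "area_density p q = sqrt (1 - p\<^sup>2 - q\<^sup>2)"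

text \<open>
  The value of \<open>\<zeta>\<close> in terms of the slope, with the singularity at slope \<open>0\<close> removed by rationalizing
  the numerator \<open>1 - W\<close>.
\<close>

definition slope_zeta :: "real \<Rightarrow> real \<Rightarrow> complex" where
  "slope_zeta p q = Complex (p / (1 + area_density p q)) (q / (1 + area_density p q))"

text \<open>
  The coefficients of \<open>dx\<close> and \<open>dy\<close> in \<open>dk\<close>, the differential of the conjugate isothermal coordinate.
\<close>

definition isothermal_dx :: "real \<Rightarrow> real \<Rightarrow> complex" where
  "isothermal_dx p q = Complex (1 + (1 - p\<^sup>2) / area_density p q) (p * q / area_density p q)"

definition isothermal_dy :: "real \<Rightarrow> real \<Rightarrow> complex" where
  "isothermal_dy p q = Complex (- (p * q / area_density p q)) (- (1 + (1 - q\<^sup>2) / area_density p q))"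

lemma area_density_props: assumes "p\<^sup>2 + q\<^sup>2 < 1" shows "area_density p q > 0" "(area_density p q)\<^sup>2 = 1 - p\<^sup>2 - q\<^sup>2"
  using assms by (auto simp: area_density_def)

lemma slope_zeta_norm_less_1: assumes "p\<^sup>2 + q\<^sup>2 < 1" shows "norm (slope_zeta p q) < 1"
proof -
  note W = area_density_props[OF assms]
  have "(norm (slope_zeta p q))\<^sup>2 = (p\<^sup>2 + q\<^sup>2) / (1 + area_density p q)\<^sup>2"
    unfolding slope_zeta_def by (simp add: cmod_power2 power_divide add_divide_distrib)
  also have "\<dots> < 1"
    using W(1) less_trans[OF assms one_less_power[of "1 + area_density p q" 2]] by (simp add: divide_less_eq_1)
  finally show ?thesis by (simp add: abs_square_less_1)
qed

text \<open>
  The Jacobian of \<open>k\<close> is \<open>-(2 + (2 - p\<^sup>2 - q\<^sup>2) / W) = -(1 + W)\<^sup>2 / W\<close>.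
\<close>

lemma isothermal_form_nondegenerate:
  assumes "p\<^sup>2 + q\<^sup>2 < 1" "Re h *\<^sub>R isothermal_dx p q + Im h *\<^sub>R isothermal_dy p q = 0"
  shows "h = 0"
proof -
  note W = area_density_props[OF assms(1)]
  define A B C where "A = 1 + (1 - p\<^sup>2) / area_density p q" and "B = p * q / area_density p q" and "C = 1 + (1 - q\<^sup>2) / area_density p q"
  have 1: "Re h * A = Im h * B" "Re h * B = Im h * C"
    using assms(2) by (auto simp: isothermal_dx_def isothermal_dy_def complex_eq_iff A_def B_def C_def algebra_simps)
  have "A * C - B\<^sup>2 = 1 + (2 - p\<^sup>2 - q\<^sup>2) / area_density p q + (1 - p\<^sup>2 - q\<^sup>2) / (area_density p q)\<^sup>2"
    using W(1) unfolding A_def B_def C_def by (simp add: field_simps power2_eq_square)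
  also have "\<dots> = 2 + (2 - p\<^sup>2 - q\<^sup>2) / area_density p q" unfolding W(2)[symmetric] using W(1) by simp
  also have "\<dots> > 0" using W(1) assms(1) by (intro add_pos_pos divide_pos_pos) auto
  finally have pos: "A * C - B\<^sup>2 \<noteq> 0" by simp
  have "Re h * (A * C - B\<^sup>2) = 0" "Im h * (A * C - B\<^sup>2) = 0"
    using 1 by algebra+
  with pos show ?thesis by (simp add: complex_eq_iff)
qed

text \<open>
  These express \<open>2 dx = Re ((1 + \<zeta>\<^sup>2) dk)\<close>, \<open>2 dy = Re (i (1 - \<zeta>\<^sup>2) dk)\<close> and
  \<open>p dx + q dy = Re (\<zeta> dk)\<close> on the two basis directions.
\<close>

lemma slope_zeta_weierstrass_identities:
  assumes "p\<^sup>2 + q\<^sup>2 < 1"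
  shows "Re ((1 + (slope_zeta p q)\<^sup>2) * isothermal_dx p q) = 2" "Re ((1 + (slope_zeta p q)\<^sup>2) * isothermal_dy p q) = 0"
    "Re (\<i> * (1 - (slope_zeta p q)\<^sup>2) * isothermal_dx p q) = 0" "Re (\<i> * (1 - (slope_zeta p q)\<^sup>2) * isothermal_dy p q) = 2"
    "Re (slope_zeta p q * isothermal_dx p q) = p" "Re (slope_zeta p q * isothermal_dy p q) = q"
proof -
  define W where "W = area_density p q"
  have W: "W > 0" "W * W = 1 - p * p - q * q" using area_density_props[OF assms] by (auto simp: W_def power2_eq_square)
  define c where "c = 1 + W"
  have c: "c > 0" using W by (simp add: c_def)
  have z2: "(slope_zeta p q)\<^sup>2 = Complex ((p\<^sup>2 - q\<^sup>2) / c\<^sup>2) (2 * p * q / c\<^sup>2)"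
    by (simp add: slope_zeta_def complex_eq_iff W_def c_def power2_eq_square add_divide_distrib diff_divide_distrib)
  have k: "isothermal_dx p q = Complex ((c - p\<^sup>2) / W) (p * q / W)" "isothermal_dy p q = Complex (- (p * q / W)) (- ((c - q\<^sup>2) / W))"
    using W(1) by (auto simp: isothermal_dx_def isothermal_dy_def complex_eq_iff c_def field_simps W_def)
  have z: "slope_zeta p q = Complex (p / c) (q / c)" by (simp add: slope_zeta_def c_def W_def)
  show "Re ((1 + (slope_zeta p q)\<^sup>2) * isothermal_dx p q) = 2"
    unfolding z2 k using W c by (simp add: field_simps power2_eq_square) (unfold c_def; use W(2) in algebra)
  show "Re ((1 + (slope_zeta p q)\<^sup>2) * isothermal_dy p q) = 0"
    unfolding z2 k using W c by (simp add: field_simps power2_eq_square) (unfold c_def; use W(2) in algebra)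
  show "Re (\<i> * (1 - (slope_zeta p q)\<^sup>2) * isothermal_dx p q) = 0"
    unfolding z2 k using W c by (simp add: field_simps power2_eq_square) (unfold c_def; use W(2) in algebra)
  show "Re (\<i> * (1 - (slope_zeta p q)\<^sup>2) * isothermal_dy p q) = 2"
    unfolding z2 k using W c by (simp add: field_simps power2_eq_square) (unfold c_def; use W(2) in algebra)
  show "Re (slope_zeta p q * isothermal_dx p q) = p"
    unfolding z k using W c by (simp add: field_simps power2_eq_square) (unfold c_def; use W(2) in algebra)
  show "Re (slope_zeta p q * isothermal_dy p q) = q"
    unfolding z k using W c by (simp add: field_simps power2_eq_square) (unfold c_def; use W(2) in algebra)
qed

lemma has_grad_area_density:
  assumes p: "has_grad p r s z" and q: "has_grad q s t z" and pq: "(p z)\<^sup>2 + (q z)\<^sup>2 < 1"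
  shows "has_grad (\<lambda>z. area_density (p z) (q z)) (- (p z * r + q z * s) / area_density (p z) (q z)) (- (p z * s + q z * t) / area_density (p z) (q z)) z"
proof -
  have "((\<lambda>z. sqrt (1 - (p z)\<^sup>2 - (q z)\<^sup>2)) has_derivative
    (\<lambda>h. - (Re h *\<^sub>R (p z * r + q z * s) + Im h *\<^sub>R (p z * s + q z * t)) / sqrt (1 - (p z)\<^sup>2 - (q z)\<^sup>2))) (at z)"
    using pq by (auto intro!: derivative_eq_intros p q simp: field_simps)
  then show ?thesis unfolding area_density_def
    by (rule has_derivative_eq_rhs) (simp add: fun_eq_iff add_divide_distrib diff_divide_distrib algebra_simps)
qed

text \<open>
  The gradient of \<open>\<zeta>\<close> is a complex multiple of that of \<open>k\<close>, which makes \<open>\<zeta>\<close> holomorphic as a function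
  of \<open>k\<close>.  Proportionality is one complex equation; after clearing denominators its real part holds
  for every slope field with symmetric derivative, and its imaginary part is the maximal surface
  equation times \<open>-(1 + W)\<^sup>2\<close>.
\<close>

lemma slope_zeta_beltrami:
  assumes p: "has_grad p r s z" and q: "has_grad q s t z" and pq: "(p z)\<^sup>2 + (q z)\<^sup>2 < 1"
    and max: "(1 - (q z)\<^sup>2) * r + 2 * p z * q z * s + (1 - (p z)\<^sup>2) * t = 0"
  obtains l where "has_grad (\<lambda>z. slope_zeta (p z) (q z)) (l * isothermal_dx (p z) (q z)) (l * isothermal_dy (p z) (q z)) z"
proof -
  define W where "W = area_density (p z) (q z)"
  define P Q where "P = p z" and "Q = q z"
  have W: "W > 0" "W\<^sup>2 = 1 - P\<^sup>2 - Q\<^sup>2" using area_density_props[OF pq] by (auto simp: W_def P_def Q_def)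
  define c where "c = 1 + W"
  have c: "c > 0" using W by (simp add: c_def)
  note gW = has_grad_area_density[OF p q pq]
  have gc: "has_grad (\<lambda>z. 1 + area_density (p z) (q z)) (- (P * r + Q * s) / W) (- (P * s + Q * t) / W) z"
    using has_grad_add[OF has_grad_const[of 1] gW] by (simp add: W_def P_def Q_def)
  have c': "1 + area_density (p z) (q z) = c" by (simp add: c_def W_def)
  have "has_grad (\<lambda>z. p z / (1 + area_density (p z) (q z))) ((r * c - P * (- (P * r + Q * s) / W)) / c\<^sup>2) ((s * c - P * (- (P * s + Q * t) / W)) / c\<^sup>2) z"
    using has_grad_divide[OF p gc] c unfolding c' P_def by simp
  moreover have "(r * c - P * (- (P * r + Q * s) / W)) / c\<^sup>2 = (r * c * W + P * (P * r + Q * s)) / (W * c\<^sup>2)"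
    "(s * c - P * (- (P * s + Q * t) / W)) / c\<^sup>2 = (s * c * W + P * (P * s + Q * t)) / (W * c\<^sup>2)"
    using W(1) c by (simp_all add: field_simps)
  ultimately have gP: "has_grad (\<lambda>z. p z / (1 + area_density (p z) (q z))) ((r * c * W + P * (P * r + Q * s)) / (W * c\<^sup>2)) ((s * c * W + P * (P * s + Q * t)) / (W * c\<^sup>2)) z"
    by (simp only:)
  have "has_grad (\<lambda>z. q z / (1 + area_density (p z) (q z))) ((s * c - Q * (- (P * r + Q * s) / W)) / c\<^sup>2) ((t * c - Q * (- (P * s + Q * t) / W)) / c\<^sup>2) z"
    using has_grad_divide[OF q gc] c unfolding c' Q_def by simp
  moreover have "(s * c - Q * (- (P * r + Q * s) / W)) / c\<^sup>2 = (s * c * W + Q * (P * r + Q * s)) / (W * c\<^sup>2)"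
    "(t * c - Q * (- (P * s + Q * t) / W)) / c\<^sup>2 = (t * c * W + Q * (P * s + Q * t)) / (W * c\<^sup>2)"
    using W(1) c by (simp_all add: field_simps)
  ultimately have gQ: "has_grad (\<lambda>z. q z / (1 + area_density (p z) (q z))) ((s * c * W + Q * (P * r + Q * s)) / (W * c\<^sup>2)) ((t * c * W + Q * (P * s + Q * t)) / (W * c\<^sup>2)) z"
    by (simp only:)
  define X1 Y1 X2 Y2 where "X1 = r * c * W + P * (P * r + Q * s)" and "Y1 = s * c * W + Q * (P * r + Q * s)"
    and "X2 = s * c * W + P * (P * s + Q * t)" and "Y2 = t * c * W + Q * (P * s + Q * t)"
  define Zx Zy where "Zx = Complex (X1 / (W * c\<^sup>2)) (Y1 / (W * c\<^sup>2))" and "Zy = Complex (X2 / (W * c\<^sup>2)) (Y2 / (W * c\<^sup>2))"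
  have gZ: "has_grad (\<lambda>z. slope_zeta (p z) (q z)) Zx Zy z"
    unfolding slope_zeta_def Zx_def Zy_def X1_def X2_def Y1_def Y2_def by (rule has_grad_Complex[OF gP gQ])
  have dx_eq: "isothermal_dx (p z) (q z) = Complex ((c - P\<^sup>2) / W) (P * Q / W)" and dy_eq: "isothermal_dy (p z) (q z) = Complex (- (P * Q / W)) (- ((c - Q\<^sup>2) / W))"
    using W(1) by (auto simp: isothermal_dx_def isothermal_dy_def complex_eq_iff c_def field_simps W_def P_def Q_def)
  \<comment> \<open>The real and imaginary part of \<open>\<zeta>\<^sub>x k\<^sub>y = \<zeta>\<^sub>y k\<^sub>x\<close>, multiplied by \<open>W\<^sup>2 c\<^sup>2\<close>.\<close>
  have re: "- (P * Q) * X1 + (c - Q\<^sup>2) * Y1 = (c - P\<^sup>2) * X2 - P * Q * Y2"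
    unfolding X1_def Y1_def X2_def Y2_def c_def using W(2) by algebra
  have im: "- (P * Q) * Y1 - (c - Q\<^sup>2) * X1 = (c - P\<^sup>2) * Y2 + P * Q * X2"
    unfolding X1_def Y1_def X2_def Y2_def c_def using W(2) max[folded P_def Q_def] by algebra
  have "Zx * isothermal_dy (p z) (q z) = Complex ((- (P * Q) * X1 + (c - Q\<^sup>2) * Y1) / (W * (W * c\<^sup>2))) ((- (P * Q) * Y1 - (c - Q\<^sup>2) * X1) / (W * (W * c\<^sup>2)))"
    unfolding Zx_def dy_eq by (simp add: complex_eq_iff add_divide_distrib diff_divide_distrib algebra_simps)
  also have "\<dots> = Zy * isothermal_dx (p z) (q z)"
    unfolding re im unfolding Zy_def dx_eq by (simp add: complex_eq_iff add_divide_distrib diff_divide_distrib algebra_simps)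
  finally have eq: "Zx * isothermal_dy (p z) (q z) = Zy * isothermal_dx (p z) (q z)" .
  have ne: "isothermal_dx (p z) (q z) \<noteq> 0" using isothermal_form_nondegenerate[OF pq, of 1] by auto
  have "Zx = (Zx / isothermal_dx (p z) (q z)) * isothermal_dx (p z) (q z)" "Zy = (Zx / isothermal_dx (p z) (q z)) * isothermal_dy (p z) (q z)"
    using eq ne by (simp_all add: field_simps)
  with gZ that show ?thesis by metis
qed

text \<open>
  The second partials of \<open>k\<close>, for \<open>r = \<phi>\<^sub>x\<^sub>x\<close>, \<open>s = \<phi>\<^sub>x\<^sub>y\<close>, \<open>t = \<phi>\<^sub>y\<^sub>y\<close>.
\<close>

definition isothermal_xx :: "real \<Rightarrow> real \<Rightarrow> real \<Rightarrow> real \<Rightarrow> complex" where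
  "isothermal_xx p q r s = Complex ((- 2 * p * r * (area_density p q)\<^sup>2 + (1 - p\<^sup>2) * (p * r + q * s)) / (area_density p q) ^ 3)
     (((r * q + p * s) * (area_density p q)\<^sup>2 + p * q * (p * r + q * s)) / (area_density p q) ^ 3)"

definition isothermal_xy :: "real \<Rightarrow> real \<Rightarrow> real \<Rightarrow> real \<Rightarrow> complex" where
  "isothermal_xy p q s t = Complex ((- 2 * p * s * (area_density p q)\<^sup>2 + (1 - p\<^sup>2) * (p * s + q * t)) / (area_density p q) ^ 3)
     (((s * q + p * t) * (area_density p q)\<^sup>2 + p * q * (p * s + q * t)) / (area_density p q) ^ 3)"

definition isothermal_yy :: "real \<Rightarrow> real \<Rightarrow> real \<Rightarrow> real \<Rightarrow> complex" where
  "isothermal_yy p q s t = Complex (- (((s * q + p * t) * (area_density p q)\<^sup>2 + p * q * (p * s + q * t)) / (area_density p q) ^ 3))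
     (- ((- 2 * q * t * (area_density p q)\<^sup>2 + (1 - q\<^sup>2) * (p * s + q * t)) / (area_density p q) ^ 3))"

lemma has_grad_divide_area_density:
  assumes p: "has_grad p r s z" and q: "has_grad q s t z" and pq: "(p z)\<^sup>2 + (q z)\<^sup>2 < 1"
    and f: "has_grad f fx fy z"
  shows "has_grad (\<lambda>z. f z / area_density (p z) (q z))
    ((fx * (area_density (p z) (q z))\<^sup>2 + f z * (p z * r + q z * s)) / area_density (p z) (q z) ^ 3)
    ((fy * (area_density (p z) (q z))\<^sup>2 + f z * (p z * s + q z * t)) / area_density (p z) (q z) ^ 3) z"
proof -
  define W where "W = area_density (p z) (q z)"
  have W: "W > 0" using area_density_props[OF pq] by (simp add: W_def)
  have e: "(u * W - v * (- w / W)) / W\<^sup>2 = (u * W\<^sup>2 + v * w) / W ^ 3" for u v w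
    using W by (simp add: field_simps power2_eq_square power3_eq_cube)
  have "has_grad (\<lambda>z. f z / area_density (p z) (q z)) ((fx * W - f z * (- (p z * r + q z * s) / W)) / W\<^sup>2)
    ((fy * W - f z * (- (p z * s + q z * t) / W)) / W\<^sup>2) z"
    using has_grad_divide[OF f has_grad_area_density[OF p q pq]] W unfolding W_def by (metis less_irrefl)
  then show ?thesis unfolding W_def e[unfolded W_def] .
qed

text \<open>
  For a graph the closedness of \<open>dk\<close> amounts to \<open>q E = 0\<close> and \<open>p E = 0\<close> (up to a nonzero factor),
  where \<open>E = 0\<close> is the maximal surface equation.
\<close>

lemma isothermal_form_closed:
  assumes p: "has_grad p r s z" and q: "has_grad q s t z" and pq: "(p z)\<^sup>2 + (q z)\<^sup>2 < 1"
    and max: "(1 - (q z)\<^sup>2) * r + 2 * p z * q z * s + (1 - (p z)\<^sup>2) * t = 0"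
  shows "has_grad (\<lambda>z. isothermal_dx (p z) (q z)) (isothermal_xx (p z) (q z) r s) (isothermal_xy (p z) (q z) s t) z"
    and "has_grad (\<lambda>z. isothermal_dy (p z) (q z)) (isothermal_xy (p z) (q z) s t) (isothermal_yy (p z) (q z) s t) z"
proof -
  define W P Q where "W = area_density (p z) (q z)" and "P = p z" and "Q = q z"
  have W2: "W\<^sup>2 = 1 - P\<^sup>2 - Q\<^sup>2" using area_density_props[OF pq] by (auto simp: W_def P_def Q_def)
  note div = has_grad_divide_area_density[OF p q pq]
  have "has_grad (\<lambda>z. 1 - (p z)\<^sup>2) (- 2 * P * r) (- 2 * P * s) z"
    using has_grad_add[OF has_grad_const[of 1] has_grad_minus[OF has_grad_mult[OF p p]]]
    by (simp add: power2_eq_square P_def algebra_simps)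
  from has_grad_add[OF has_grad_const[of 1] div[OF this]] have f1: "has_grad (\<lambda>z. 1 + (1 - (p z)\<^sup>2) / area_density (p z) (q z))
    ((- 2 * P * r * W\<^sup>2 + (1 - P\<^sup>2) * (P * r + Q * s)) / W ^ 3) ((- 2 * P * s * W\<^sup>2 + (1 - P\<^sup>2) * (P * s + Q * t)) / W ^ 3) z"
    unfolding W_def P_def Q_def add_0 .
  have f2: "has_grad (\<lambda>z. p z * q z / area_density (p z) (q z))
    (((r * Q + P * s) * W\<^sup>2 + P * Q * (P * r + Q * s)) / W ^ 3) (((s * Q + P * t) * W\<^sup>2 + P * Q * (P * s + Q * t)) / W ^ 3) z"
    using div[OF has_grad_mult[OF p q]] unfolding W_def P_def Q_def .
  have "has_grad (\<lambda>z. 1 - (q z)\<^sup>2) (- 2 * Q * s) (- 2 * Q * t) z"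
    using has_grad_add[OF has_grad_const[of 1] has_grad_minus[OF has_grad_mult[OF q q]]]
    by (simp add: power2_eq_square Q_def algebra_simps)
  from has_grad_add[OF has_grad_const[of 1] div[OF this]] have f3: "has_grad (\<lambda>z. 1 + (1 - (q z)\<^sup>2) / area_density (p z) (q z))
    ((- 2 * Q * s * W\<^sup>2 + (1 - Q\<^sup>2) * (P * r + Q * s)) / W ^ 3) ((- 2 * Q * t * W\<^sup>2 + (1 - Q\<^sup>2) * (P * s + Q * t)) / W ^ 3) z"
    unfolding W_def P_def Q_def add_0 .
  show "has_grad (\<lambda>z. isothermal_dx (p z) (q z)) (isothermal_xx (p z) (q z) r s) (isothermal_xy (p z) (q z) s t) z"
    using has_grad_Complex[OF f1 f2] unfolding isothermal_dx_def isothermal_xx_def isothermal_xy_def W_def P_def Q_def .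
  have c1: "- ((r * Q + P * s) * W\<^sup>2 + P * Q * (P * r + Q * s)) = - 2 * P * s * W\<^sup>2 + (1 - P\<^sup>2) * (P * s + Q * t)"
    using W2 max[folded P_def Q_def] by algebra
  have c2: "- (- 2 * Q * s * W\<^sup>2 + (1 - Q\<^sup>2) * (P * r + Q * s)) = (s * Q + P * t) * W\<^sup>2 + P * Q * (P * s + Q * t)"
    using W2 max[folded P_def Q_def] by algebra
  show "has_grad (\<lambda>z. isothermal_dy (p z) (q z)) (isothermal_xy (p z) (q z) s t) (isothermal_yy (p z) (q z) s t) z"
    using has_grad_Complex[OF has_grad_minus[OF f2] has_grad_minus[OF f3]]
    unfolding minus_divide_left c1 c2 unfolding isothermal_xy_def isothermal_dy_def isothermal_yy_def W_def P_def Q_def minus_divide_left .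
qed

lemma continuous_on_slope_functions:
  fixes p q r s :: "'a::topological_space \<Rightarrow> real"
  assumes c: "continuous_on S p" "continuous_on S q" "continuous_on S r" "continuous_on S s"
    and pq: "\<And>x. x \<in> S \<Longrightarrow> (p x)\<^sup>2 + (q x)\<^sup>2 < 1"
  shows "continuous_on S (\<lambda>x. isothermal_xx (p x) (q x) (r x) (s x))"
    "continuous_on S (\<lambda>x. isothermal_xy (p x) (q x) (r x) (s x))"
    "continuous_on S (\<lambda>x. isothermal_yy (p x) (q x) (r x) (s x))"
    "continuous_on S (\<lambda>x. slope_zeta (p x) (q x))"
proof -
  have W: "continuous_on S (\<lambda>x. area_density (p x) (q x))" unfolding area_density_def by (intro continuous_intros c)
  have n: "area_density (p x) (q x) ^ 3 \<noteq> 0" "1 + area_density (p x) (q x) \<noteq> 0" if "x \<in> S" for x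
    using area_density_props(1)[OF pq[OF that]] by auto
  show "continuous_on S (\<lambda>x. isothermal_xx (p x) (q x) (r x) (s x))"
    "continuous_on S (\<lambda>x. isothermal_xy (p x) (q x) (r x) (s x))"
    "continuous_on S (\<lambda>x. isothermal_yy (p x) (q x) (r x) (s x))"
    "continuous_on S (\<lambda>x. slope_zeta (p x) (q x))"
    unfolding isothermal_xx_def isothermal_xy_def isothermal_yy_def slope_zeta_def
    by (intro continuous_on_Complex continuous_intros c W ballI n; assumption)+
qed

section \<open>Weierstrass data of a solution of the maximal surface equation\<close>

text \<open>
  The representation for a solution of the maximal surface equation, as a statement about functions of
  two real variables.  Injectivity of \<open>\<zeta>\<close> is what excludes branch points of \<open>\<sigma>\<close>; without it
  \<open>\<zeta>\<close> would only be a holomorphic function on the surface.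
\<close>

lemma weierstrass_data_of_graph:
  fixes p q r s t \<phi> :: "complex \<Rightarrow> real"
  defines "Z \<equiv> \<lambda>z. slope_zeta (p z) (q z)"
  assumes D: "open D" "z0 \<in> D"
    and \<phi>: "\<And>z. z \<in> D \<Longrightarrow> has_grad \<phi> (p z) (q z) z"
    and p: "\<And>z. z \<in> D \<Longrightarrow> has_grad p (r z) (s z) z"
    and q: "\<And>z. z \<in> D \<Longrightarrow> has_grad q (s z) (t z) z"
    and cont: "continuous_on D r" "continuous_on D s" "continuous_on D t"
    and pq: "\<And>z. z \<in> D \<Longrightarrow> (p z)\<^sup>2 + (q z)\<^sup>2 < 1"
    and max: "\<And>z. z \<in> D \<Longrightarrow> (1 - (q z)\<^sup>2) * r z + 2 * p z * q z * s z + (1 - (p z)\<^sup>2) * t z = 0"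
    and inj: "inj_on Z D"
  obtains D' \<epsilon> g M F1 F2 F3 x0 y0 c0 where
    "open D'" "z0 \<in> D'" "D' \<subseteq> D" "homeomorphism D' (ball (Z z0) \<epsilon>) Z g"
    "M holomorphic_on ball (Z z0) \<epsilon>" "\<And>\<omega>. \<omega> \<in> ball (Z z0) \<epsilon> \<Longrightarrow> M \<omega> \<noteq> 0"
    "\<And>\<omega>. \<omega> \<in> ball (Z z0) \<epsilon> \<Longrightarrow> norm \<omega> < 1"
    "\<And>\<omega>. \<omega> \<in> ball (Z z0) \<epsilon> \<Longrightarrow> (F1 has_field_derivative M \<omega> * (1 + \<omega>\<^sup>2)) (at \<omega>)"
    "\<And>\<omega>. \<omega> \<in> ball (Z z0) \<epsilon> \<Longrightarrow> (F2 has_field_derivative \<i> * M \<omega> * (1 - \<omega>\<^sup>2)) (at \<omega>)"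
    "\<And>\<omega>. \<omega> \<in> ball (Z z0) \<epsilon> \<Longrightarrow> (F3 has_field_derivative 2 * M \<omega> * \<omega>) (at \<omega>)"
    "\<And>\<omega>. \<omega> \<in> ball (Z z0) \<epsilon> \<Longrightarrow> Re (g \<omega>) = x0 + Re (F1 \<omega>)"
    "\<And>\<omega>. \<omega> \<in> ball (Z z0) \<epsilon> \<Longrightarrow> Im (g \<omega>) = y0 + Re (F2 \<omega>)"
    "\<And>\<omega>. \<omega> \<in> ball (Z z0) \<epsilon> \<Longrightarrow> \<phi> (g \<omega>) = c0 + Re (F3 \<omega>)"
proof -
  define a b where "a = (\<lambda>z. isothermal_dx (p z) (q z))" and "b = (\<lambda>z. isothermal_dy (p z) (q z))"
  have contpq: "continuous_on D p" "continuous_on D q"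
    using p q by (meson continuous_at_imp_continuous_on has_derivative_continuous)+
  have contZ: "continuous_on D Z"
    unfolding Z_def by (rule continuous_on_slope_functions(4)[OF contpq cont(1,2) pq])
  obtain \<rho> where \<rho>: "\<rho> > 0" "ball z0 \<rho> \<subseteq> D" using D openE by blast
  define B where "B = ball z0 \<rho>"
  have B: "open B" "convex B" "z0 \<in> B" "B \<subseteq> D" using \<rho> by (auto simp: B_def)
  note k_partials = isothermal_form_closed[OF p q pq max]
  have ga: "has_grad a (isothermal_xx (p z) (q z) (r z) (s z)) (isothermal_xy (p z) (q z) (s z) (t z)) z"
    and gb: "has_grad b (isothermal_xy (p z) (q z) (s z) (t z)) (isothermal_yy (p z) (q z) (s z) (t z)) z" if "z \<in> B" for z
    using k_partials that B(4) unfolding a_def b_def by blast+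
  have pqB: "\<And>x. x \<in> B \<Longrightarrow> (p x)\<^sup>2 + (q x)\<^sup>2 < 1" using pq B(4) by blast
  note contB = contpq[THEN continuous_on_subset[OF _ B(4)]] cont[THEN continuous_on_subset[OF _ B(4)]]
  obtain k where k: "\<And>z. z \<in> B \<Longrightarrow> has_grad k (a z) (b z) z"
    by (rule closed_form_has_primitive[OF B(1,2) ga gb])
      (use continuous_on_slope_functions[OF contB(1,2) _ _ pqB] contB(3-5) in auto)
  have contab: "continuous_on B a" "continuous_on B b"
    using ga gb by (meson continuous_at_imp_continuous_on has_derivative_continuous)+
  obtain U V0 m m' where U: "open U" "U \<subseteq> B" "z0 \<in> U" "open V0" "homeomorphism U V0 k m"
    and m': "\<And>y. y \<in> V0 \<Longrightarrow> (m has_derivative m' y) (at y)"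
    "\<And>y h. y \<in> V0 \<Longrightarrow> Re (m' y h) *\<^sub>R a (m y) + Im (m' y h) *\<^sub>R b (m y) = h"
    using plane_inverse_function[OF B(1,3) k contab] isothermal_form_nondegenerate[OF pqB[OF B(3)]]
    unfolding a_def b_def by metis
  have mV: "m y \<in> U" "m y \<in> D" "k (m y) = y" if "y \<in> V0" for y
    using U(2,5) B(4) that unfolding homeomorphism_def by blast+
  have kU: "k z \<in> V0" "m (k z) = z" if "z \<in> U" for z
    using U(5) that unfolding homeomorphism_def by blast+
  \<comment> \<open>\<open>\<sigma>\<close> is \<open>\<zeta>\<close> as a function of the isothermal coordinate \<open>k\<close>.\<close>
  define \<sigma> where "\<sigma> = (\<lambda>y. Z (m y))"
  have \<sigma>_deriv: "\<exists>l. (\<sigma> has_field_derivative l) (at y)" if y: "y \<in> V0" for y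
  proof -
    note my = mV(2)[OF y]
    obtain l where l: "has_grad Z (l * a (m y)) (l * b (m y)) (m y)"
      using slope_zeta_beltrami[OF p[OF my] q[OF my] pq[OF my] max[OF my]] unfolding Z_def a_def b_def by blast
    have "(\<sigma> has_derivative (\<lambda>h. l * h)) (at y)"
      unfolding \<sigma>_def
    proof (rule has_derivative_eq_rhs[OF has_derivative_compose[OF m'(1)[OF y] l]], rule ext)
      fix h
      have "Re (m' y h) *\<^sub>R (l * a (m y)) + Im (m' y h) *\<^sub>R (l * b (m y))
        = l * (Re (m' y h) *\<^sub>R a (m y) + Im (m' y h) *\<^sub>R b (m y))" by (simp add: algebra_simps)
      then show "Re (m' y h) *\<^sub>R (l * a (m y)) + Im (m' y h) *\<^sub>R (l * b (m y)) = l * h"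
        unfolding m'(2)[OF y] .
    qed
    then show ?thesis by (auto simp: has_field_derivative_def)
  qed
  have hol: "\<sigma> holomorphic_on V0"
    using \<sigma>_deriv U(4) by (auto simp: holomorphic_on_open)
  have inj\<sigma>: "inj_on \<sigma> V0"
    by (rule inj_onI) (metis \<sigma>_def inj inj_onD mV(2,3))
  obtain j where j: "j holomorphic_on \<sigma> ` V0" "\<And>y. y \<in> V0 \<Longrightarrow> deriv \<sigma> y * deriv j (\<sigma> y) = 1"
    "\<And>y. y \<in> V0 \<Longrightarrow> j (\<sigma> y) = y"
    using holomorphic_has_inverse[OF hol U(4) inj\<sigma>] by metis
  have "open (\<sigma> ` V0)" by (rule open_mapping_thm3[OF hol U(4) inj\<sigma>])
  moreover have "Z z0 \<in> \<sigma> ` V0" using kU[OF U(3)] unfolding \<sigma>_def by (metis image_eqI)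
  ultimately obtain \<epsilon> where \<epsilon>: "\<epsilon> > 0" "ball (Z z0) \<epsilon> \<subseteq> \<sigma> ` V0" using openE by blast
  define V where "V = ball (Z z0) \<epsilon>"
  have V: "open V" "convex V" "Z z0 \<in> V" "V \<subseteq> \<sigma> ` V0" using \<epsilon> by (auto simp: V_def)
  define g where "g = (\<lambda>\<omega>. m (j \<omega>))"
  have jV: "j \<omega> \<in> V0" "\<sigma> (j \<omega>) = \<omega>" "g \<omega> \<in> U" "g \<omega> \<in> D" "Z (g \<omega>) = \<omega>" if "\<omega> \<in> V" for \<omega>
    using V(4) j(3) that mV unfolding g_def \<sigma>_def by force+
  define D' where "D' = U \<inter> Z -` V"
  have D'D: "D' \<subseteq> D" using U(2) B(4) by (auto simp: D'_def)
  have "open D'"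
    unfolding D'_def using U B continuous_on_subset[OF contZ, of U] V(1)
    by (intro continuous_open_preimage) auto
  have gZ: "g (Z z) = z" if "z \<in> D'" for z
    using jV(4,5)[of "Z z"] that D'D inj by (auto simp: D'_def dest!: inj_onD)
  have holj: "j holomorphic_on V" using j(1) V(4) holomorphic_on_subset by blast
  \<comment> \<open>The coordinate \<open>k\<close> is \<open>j\<close> as a function of \<open>\<zeta>\<close>, so this says \<open>dk = 2 M d\<zeta>\<close>.\<close>
  define M where "M = (\<lambda>\<omega>. deriv j \<omega> / 2)"
  have holM: "M holomorphic_on V" unfolding M_def by (intro holomorphic_intros holj V(1)) auto
  have M0: "M \<omega> \<noteq> 0" if "\<omega> \<in> V" for \<omega>
    using j(2)[OF jV(1)[OF that]] jV(2)[OF that] by (auto simp: M_def)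
  define g' where "g' = (\<lambda>\<omega> h. m' (j \<omega>) (2 * M \<omega> * h))"
  have gd: "(g has_derivative g' \<omega>) (at \<omega>)" if w: "\<omega> \<in> V" for \<omega>
  proof -
    have dj: "(j has_derivative (\<lambda>h. 2 * M \<omega> * h)) (at \<omega>)"
      using holomorphic_derivI[OF holj V(1) w] unfolding M_def has_field_derivative_def by simp
    show ?thesis
      unfolding g_def g'_def by (rule has_derivative_compose[OF dj m'(1)[OF jV(1)[OF w]]])
  qed
  have g'_eq: "2 * M \<omega> * h = Re (g' \<omega> h) *\<^sub>R a (g \<omega>) + Im (g' \<omega> h) *\<^sub>R b (g \<omega>)" if w: "\<omega> \<in> V" for \<omega> h
    using m'(2)[OF jV(1)[OF w]] unfolding g'_def g_def by simp
  have homeo: "homeomorphism D' V Z g"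
  proof (rule homeomorphismI)
    show "continuous_on D' Z" using contZ D'D continuous_on_subset by blast
    show "continuous_on V g" using gd by (meson continuous_at_imp_continuous_on has_derivative_continuous)
  qed (use jV gZ in \<open>auto simp: D'_def\<close>)
  \<comment> \<open>The real-linear functional \<open>Re (L dk)\<close> in the basis \<open>dx\<close>, \<open>dy\<close>.\<close>
  have lin: "Re (L * (2 * M \<omega> * h)) = Re (g' \<omega> h) * Re (L * a (g \<omega>)) + Im (g' \<omega> h) * Re (L * b (g \<omega>))"
    if "\<omega> \<in> V" for L \<omega> h
    unfolding g'_eq[OF that] by (simp add: algebra_simps)
  have norm1: "norm \<omega> < 1" if "\<omega> \<in> V" for \<omega>
    using slope_zeta_norm_less_1[OF pq[OF jV(4)[OF that]]] jV(5)[OF that] by (simp add: Z_def)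
  have w: "Re ((1 + \<omega>\<^sup>2) * a (g \<omega>)) = 2" "Re ((1 + \<omega>\<^sup>2) * b (g \<omega>)) = 0"
    "Re (\<i> * (1 - \<omega>\<^sup>2) * a (g \<omega>)) = 0" "Re (\<i> * (1 - \<omega>\<^sup>2) * b (g \<omega>)) = 2"
    "Re (\<omega> * a (g \<omega>)) = p (g \<omega>)" "Re (\<omega> * b (g \<omega>)) = q (g \<omega>)" if "\<omega> \<in> V" for \<omega>
    using slope_zeta_weierstrass_identities[OF pq[OF jV(4)[OF that]]] jV(5)[OF that] unfolding Z_def a_def b_def by simp_all
  \<comment> \<open>A real function on the disc whose differential is \<open>Re (G d\<omega>)\<close> is \<open>Re (\<integral> G)\<close> up to a constant.\<close>
  have integrate: "\<exists>F c. (\<forall>\<omega>\<in>V. (F has_field_derivative G \<omega>) (at \<omega>)) \<and> (\<forall>\<omega>\<in>V. X \<omega> = c + Re (F \<omega>))"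
    if G: "G holomorphic_on V" and X: "\<And>\<omega>. \<omega> \<in> V \<Longrightarrow> (X has_derivative (\<lambda>h. Re (G \<omega> * h))) (at \<omega>)"
    for G and X :: "complex \<Rightarrow> real"
  proof -
    obtain F where F: "\<And>\<omega>. \<omega> \<in> V \<Longrightarrow> (F has_field_derivative G \<omega>) (at \<omega>)"
      using holomorphic_convex_primitive'[OF V(2,1) G] V(1) by (metis at_within_open)
    have "((\<lambda>\<omega>. X \<omega> - Re (F \<omega>)) has_derivative (\<lambda>h. 0)) (at \<omega> within V)" if "\<omega> \<in> V" for \<omega>
    proof -
      have "((\<lambda>\<omega>. X \<omega> - Re (F \<omega>)) has_derivative (\<lambda>h. Re (G \<omega> * h) - Re (G \<omega> * h))) (at \<omega>)"
        using F[OF that] unfolding has_field_derivative_def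
        by (intro has_derivative_diff X that has_derivative_Re)
      then show ?thesis using has_derivative_at_withinI by fastforce
    qed
    then obtain c where "\<forall>\<omega>\<in>V. X \<omega> - Re (F \<omega>) = c" using has_derivative_zero_constant[OF V(2)] by blast
    then have "\<forall>\<omega>\<in>V. X \<omega> = c + Re (F \<omega>)" by (auto simp: algebra_simps)
    with F show ?thesis by blast
  qed
  have h1: "(\<lambda>\<omega>. M \<omega> * (1 + \<omega>\<^sup>2)) holomorphic_on V" by (intro holomorphic_intros holM)
  have d1: "((\<lambda>\<omega>. Re (g \<omega>)) has_derivative (\<lambda>h. Re (M \<omega> * (1 + \<omega>\<^sup>2) * h))) (at \<omega>)" if "\<omega> \<in> V" for \<omega>
  proof (rule has_derivative_eq_rhs[OF has_derivative_Re[OF gd[OF that]]], rule ext)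
    fix h
    have "2 * Re (M \<omega> * (1 + \<omega>\<^sup>2) * h) = Re ((1 + \<omega>\<^sup>2) * (2 * M \<omega> * h))" by (simp add: algebra_simps)
    then show "Re (g' \<omega> h) = Re (M \<omega> * (1 + \<omega>\<^sup>2) * h)" unfolding lin[OF that] w[OF that] by simp
  qed
  obtain F1 x0 where 1: "\<forall>\<omega>\<in>V. (F1 has_field_derivative M \<omega> * (1 + \<omega>\<^sup>2)) (at \<omega>)"
    "\<forall>\<omega>\<in>V. Re (g \<omega>) = x0 + Re (F1 \<omega>)" using integrate[OF h1 d1] by blast
  have h2: "(\<lambda>\<omega>. \<i> * M \<omega> * (1 - \<omega>\<^sup>2)) holomorphic_on V" by (intro holomorphic_intros holM)
  have d2: "((\<lambda>\<omega>. Im (g \<omega>)) has_derivative (\<lambda>h. Re (\<i> * M \<omega> * (1 - \<omega>\<^sup>2) * h))) (at \<omega>)" if "\<omega> \<in> V" for \<omega>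
  proof (rule has_derivative_eq_rhs[OF has_derivative_Im[OF gd[OF that]]], rule ext)
    fix h
    have "2 * Re (\<i> * M \<omega> * (1 - \<omega>\<^sup>2) * h) = Re (\<i> * (1 - \<omega>\<^sup>2) * (2 * M \<omega> * h))" by (simp add: algebra_simps)
    then show "Im (g' \<omega> h) = Re (\<i> * M \<omega> * (1 - \<omega>\<^sup>2) * h)" unfolding lin[OF that] w[OF that] by simp
  qed
  obtain F2 y0 where 2: "\<forall>\<omega>\<in>V. (F2 has_field_derivative \<i> * M \<omega> * (1 - \<omega>\<^sup>2)) (at \<omega>)"
    "\<forall>\<omega>\<in>V. Im (g \<omega>) = y0 + Re (F2 \<omega>)" using integrate[OF h2 d2] by blast
  have h3: "(\<lambda>\<omega>. 2 * M \<omega> * \<omega>) holomorphic_on V" by (intro holomorphic_intros holM)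
  have d3: "((\<lambda>\<omega>. \<phi> (g \<omega>)) has_derivative (\<lambda>h. Re (2 * M \<omega> * \<omega> * h))) (at \<omega>)" if "\<omega> \<in> V" for \<omega>
  proof (rule has_derivative_eq_rhs[OF has_derivative_compose[OF gd[OF that] \<phi>[OF jV(4)[OF that]]]], rule ext)
    fix h
    have "Re (2 * M \<omega> * \<omega> * h) = Re (\<omega> * (2 * M \<omega> * h))" by (simp add: algebra_simps)
    then show "Re (g' \<omega> h) *\<^sub>R p (g \<omega>) + Im (g' \<omega> h) *\<^sub>R q (g \<omega>) = Re (2 * M \<omega> * \<omega> * h)"
      unfolding lin[OF that] w[OF that] by simp
  qed
  obtain F3 c0 where 3: "\<forall>\<omega>\<in>V. (F3 has_field_derivative 2 * M \<omega> * \<omega>) (at \<omega>)"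
    "\<forall>\<omega>\<in>V. \<phi> (g \<omega>) = c0 + Re (F3 \<omega>)" using integrate[OF h3 d3] by blast
  show ?thesis
  proof (rule that[OF \<open>open D'\<close> _ D'D, of \<epsilon> g M F1 F2 F3 x0 y0 c0, folded V_def])
    show "z0 \<in> D'" using U(3) V(3) by (simp add: D'_def)
  qed (use homeo holM M0 norm1 1 2 3 in auto)
qed

section \<open>Charts of a surface\<close>

text \<open>
  \<open>C\<^sup>k\<close> regularity of a local inverse \<open>m\<close> of \<open>(\<alpha>, \<beta>)\<close>.  By Cramer's rule a directional derivative of
  \<open>\<gamma> \<circ> m\<close> is again of the form \<open>b \<circ> m\<close> with \<open>b\<close> smooth, since it involves \<open>m\<close> only through
  the partials of \<open>\<alpha>\<close>, \<open>\<beta>\<close>, \<open>\<gamma>\<close> at \<open>m y\<close>.  So induction on \<open>k\<close>, for all smooth \<open>\<gamma>\<close> at once,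
  needs no chain rule of higher order.
\<close>

lemma smooth_on_compose_local_inverse:
  fixes \<alpha> \<beta> \<gamma> :: "complex \<Rightarrow> real" and m :: "complex \<Rightarrow> complex"
  assumes "open U" "open V"
    and sm: "smooth_on \<alpha> U" "smooth_on \<beta> U" "smooth_on \<gamma> U"
    and mU: "\<And>y. y \<in> V \<Longrightarrow> m y \<in> U"
    and m': "\<And>y. y \<in> V \<Longrightarrow> (m has_derivative m' y) (at y)"
    and Re_m': "\<And>y h. y \<in> V \<Longrightarrow> Re (m' y h) * pdx \<alpha> (m y) + Im (m' y h) * pdy \<alpha> (m y) = Re h"
    and Im_m': "\<And>y h. y \<in> V \<Longrightarrow> Re (m' y h) * pdx \<beta> (m y) + Im (m' y h) * pdy \<beta> (m y) = Im h"
    and J0: "\<And>w. w \<in> U \<Longrightarrow> pdx \<alpha> w * pdy \<beta> w - pdy \<alpha> w * pdx \<beta> w \<noteq> 0"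
  shows "smooth_on (\<lambda>y. \<gamma> (m y)) V"
proof -
  define J where "J = (\<lambda>w. pdx \<alpha> w * pdy \<beta> w - pdy \<alpha> w * pdx \<beta> w)"
  have minus: "smooth_on (\<lambda>x. - f x) U" if "smooth_on f U" for f :: "complex \<Rightarrow> real"
    using smooth_on_bounded_linear[OF assms(1) bounded_linear_minus[OF bounded_linear_ident] that] .
  have J: "smooth_on J U"
    unfolding J_def diff_conv_add_uminus
    by (intro smooth_on_add smooth_on_mult minus smooth_on_pd sm assms(1))
  have invJ: "smooth_on (\<lambda>w. inverse (J w)) U"
    by (rule smooth_on_inverse[OF assms(1) J]) (use J0 in \<open>auto simp: J_def\<close>)
  have "C_k_on k (\<lambda>y. \<gamma> (m y)) V" for k
    using sm(3)
  proof (induction k arbitrary: \<gamma>)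
    case 0
    have "continuous_on V m" using m' by (meson continuous_at_imp_continuous_on has_derivative_continuous)
    then show ?case
      using continuous_on_compose2[OF smooth_on_imp_continuous_on[OF 0], of V m] mU by auto
  next
    case (Suc k)
    define b where "b = (\<lambda>h w. pdx \<gamma> w * ((pdy \<beta> w * Re h + - (pdy \<alpha> w * Im h)) * inverse (J w))
      + pdy \<gamma> w * ((- (pdx \<beta> w * Re h) + pdx \<alpha> w * Im h) * inverse (J w)))"
    have b: "smooth_on (b h) U" for h
      unfolding b_def
      by (intro smooth_on_add smooth_on_mult minus smooth_on_pd sm assms(1) invJ Suc.prems smooth_on_const)
    have "((\<lambda>y. \<gamma> (m y)) has_derivative (\<lambda>h. b h (m y))) (at y)" if y: "y \<in> V" for y
    proof (rule has_derivative_eq_rhs[OF has_derivative_compose[OF m'[OF y] smooth_on_has_derivative_pd[OF Suc.prems mU[OF y]]]], rule ext)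
      fix h
      have "J (m y) \<noteq> 0" using J0[OF mU[OF y]] by (simp add: J_def)
      have "Re (m' y h) * J (m y) = pdy \<beta> (m y) * Re h - pdy \<alpha> (m y) * Im h"
        unfolding J_def Re_m'[OF y, of h, symmetric] Im_m'[OF y, of h, symmetric] by (simp add: algebra_simps)
      moreover have "Im (m' y h) * J (m y) = - (pdx \<beta> (m y) * Re h) + pdx \<alpha> (m y) * Im h"
        unfolding J_def Re_m'[OF y, of h, symmetric] Im_m'[OF y, of h, symmetric] by (simp add: algebra_simps)
      ultimately have "Re (m' y h) = (pdy \<beta> (m y) * Re h + - (pdy \<alpha> (m y) * Im h)) * inverse (J (m y))"
        "Im (m' y h) = (- (pdx \<beta> (m y) * Re h) + pdx \<alpha> (m y) * Im h) * inverse (J (m y))"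
        using \<open>J (m y) \<noteq> 0\<close> by (simp_all add: field_simps)
      then show "Re (m' y h) *\<^sub>R pdx \<gamma> (m y) + Im (m' y h) *\<^sub>R pdy \<gamma> (m y) = b h (m y)"
        by (simp add: b_def mult_ac)
    qed
    then show ?case
      by (rule C_k_on_SucI[OF assms(2)]) (use Suc.IH b in auto)
  qed
  then show ?thesis by (simp add: smooth_on_def)
qed

lemma embedding_map_reparam:
  assumes c: "embedding_map (top_of_set D) S c" "openin S (c ` D)"
    and g: "homeomorphism D' V Z g" "open D'" "D' \<subseteq> D"
  shows "embedding_map (top_of_set V) S (c \<circ> g)" "openin S ((c \<circ> g) ` V)"
proof -
  have gV: "g ` V = D'" using g(1) by (simp add: homeomorphism_def)
  have inj: "inj_on g V" using g(1) by (metis homeomorphism_apply2 inj_on_def)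
  have "open_map (top_of_set V) (top_of_set D') g"
    using homeomorphism_imp_open_map[OF g(1)[THEN homeomorphism_sym[THEN iffD1]]] by (simp add: open_map_def)
  moreover have "openin (top_of_set D) D'" using g by (blast intro: open_subset)
  ultimately have "open_map (top_of_set V) (top_of_set D) g"
    unfolding open_map_def by (meson openin_trans)
  moreover have "continuous_map (top_of_set V) (top_of_set D) g"
    using g by (auto simp: homeomorphism_def)
  ultimately have "embedding_map (top_of_set V) (top_of_set D) g"
    using inj by (intro injective_open_imp_embedding_map) auto
  then show "embedding_map (top_of_set V) S (c \<circ> g)" by (rule embedding_map_compose[OF _ c(1)])
  have "open_map (top_of_set D) (subtopology S (c ` D)) c"
    using c(1) unfolding embedding_map_def by (simp add: homeomorphic_imp_open_map)
  then have "openin (subtopology S (c ` D)) (c ` D')"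
    using \<open>openin (top_of_set D) D'\<close> by (auto simp: open_map_def)
  then have "openin S (c ` D')" using c(2) by (rule openin_trans_full)
  then show "openin S ((c \<circ> g) ` V)" by (simp add: gV flip: image_image image_comp)
qed

lemma local_param_reparam:
  assumes c: "local_param S f D c"
    and g: "homeomorphism D' V Z g" "open D'" "D' \<subseteq> D" "open V"
    and X: "smooth_on (f \<circ> (c \<circ> g)) V" "\<And>w. w \<in> V \<Longrightarrow> inj (frechet_derivative (f \<circ> (c \<circ> g)) (at w))"
  shows "local_param S f V (c \<circ> g)"
  using assms embedding_map_reparam[OF _ _ g(1-3), of S c] unfolding local_param_def by blast

lemma has_derivative_vector3:
  fixes f1 f2 f3 :: "'a::real_normed_vector \<Rightarrow> real"
  assumes "(f1 has_derivative f1') F" "(f2 has_derivative f2') F" "(f3 has_derivative f3') F"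
  shows "((\<lambda>x. vector [f1 x, f2 x, f3 x] :: real^3) has_derivative (\<lambda>h. vector [f1' h, f2' h, f3' h])) F"
proof -
  have v: "(vector [a, b, c] :: real^3) = a *\<^sub>R axis 1 1 + b *\<^sub>R axis 2 1 + c *\<^sub>R axis 3 1" for a b c
    by (simp add: vec_eq_iff forall_3 axis_def)
  show ?thesis unfolding v
    by (intro has_derivative_add bounded_linear.has_derivative[OF bounded_linear_scaleR_left] assms)
qed

text \<open>
  The real part of an isotropic holomorphic curve is isothermal: for \<open>\<Phi> = (A, B, C)\<close> with
  \<open>\<Phi> \<cdot> \<Phi> = 0\<close> in the complexified Lorentz form, the partials of \<open>Re (\<integral> \<Phi>)\<close> are \<open>Re \<Phi>\<close> and
  \<open>- Im \<Phi>\<close>, and the real and imaginary parts of \<open>\<Phi> \<cdot> \<Phi> = 0\<close> say that they have equal length and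
  are orthogonal.  It is an immersion where \<open>|\<omega>| < 1\<close> and \<open>M \<noteq> 0\<close>.
\<close>

lemma isotropic_curve_immersion:
  fixes X :: "complex \<Rightarrow> real^3"
  assumes V: "open V" and M0: "\<And>\<omega>. \<omega> \<in> V \<Longrightarrow> M \<omega> \<noteq> 0" and n: "\<And>\<omega>. \<omega> \<in> V \<Longrightarrow> norm \<omega> < 1"
    and F: "\<And>\<omega>. \<omega> \<in> V \<Longrightarrow> (F1 has_field_derivative M \<omega> * (1 + \<omega>\<^sup>2)) (at \<omega>)"
      "\<And>\<omega>. \<omega> \<in> V \<Longrightarrow> (F2 has_field_derivative \<i> * M \<omega> * (1 - \<omega>\<^sup>2)) (at \<omega>)"
      "\<And>\<omega>. \<omega> \<in> V \<Longrightarrow> (F3 has_field_derivative 2 * M \<omega> * \<omega>) (at \<omega>)"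
    and X: "\<And>\<omega>. \<omega> \<in> V \<Longrightarrow> X \<omega> = vector [x0 + Re (F1 \<omega>), y0 + Re (F2 \<omega>), c0 + Re (F3 \<omega>)]"
  shows "smooth_on X V"
    and "\<And>\<omega>. \<omega> \<in> V \<Longrightarrow> inj (frechet_derivative X (at \<omega>))"
    and "\<And>\<omega>. \<omega> \<in> V \<Longrightarrow> mink (pdx X \<omega>) (pdx X \<omega>) = mink (pdy X \<omega>) (pdy X \<omega>)"
    and "\<And>\<omega>. \<omega> \<in> V \<Longrightarrow> mink (pdx X \<omega>) (pdy X \<omega>) = 0"
proof -
  have "F1 holomorphic_on V" "F2 holomorphic_on V" "F3 holomorphic_on V"
    using F V by (auto simp: holomorphic_on_open)
  then have "smooth_on (\<lambda>\<omega>. vector [Re (F1 \<omega>), Re (F2 \<omega>), Re (F3 \<omega>)] :: real^3) V"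
    by (intro smooth_on_vector3 smooth_on_Re_holomorphic V)
  from smooth_on_add[OF V smooth_on_const[of "vector [x0, y0, c0]"] this]
  show "smooth_on X V"
    by (rule smooth_on_cong[OF V, rotated]) (simp add: X vec_eq_iff forall_3)
  fix \<omega> assume w: "\<omega> \<in> V"
  have "((\<lambda>\<omega>. vector [x0 + Re (F1 \<omega>), y0 + Re (F2 \<omega>), c0 + Re (F3 \<omega>)] :: real^3) has_derivative
    (\<lambda>h. vector [0 + Re (M \<omega> * (1 + \<omega>\<^sup>2) * h), 0 + Re (\<i> * M \<omega> * (1 - \<omega>\<^sup>2) * h), 0 + Re (2 * M \<omega> * \<omega> * h)])) (at \<omega>)"
    using F[OF w] unfolding has_field_derivative_def
    by (intro has_derivative_vector3 has_derivative_add has_derivative_const has_derivative_Re)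
  then have der: "(X has_derivative (\<lambda>h. vector [Re (M \<omega> * (1 + \<omega>\<^sup>2) * h), Re (\<i> * M \<omega> * (1 - \<omega>\<^sup>2) * h), Re (2 * M \<omega> * \<omega> * h)])) (at \<omega>)"
    unfolding add_0 by (rule has_derivative_transform_within_open[OF _ V w]) (simp add: X)
  have "h = 0" if h: "frechet_derivative X (at \<omega>) h = 0" for h
  proof -
    define H where "H = M \<omega> * h"
    \<comment> \<open>The first two components of the derivative vanish iff \<open>H = - cnj (H \<omega>\<^sup>2)\<close>, impossible for
      \<open>H \<noteq> 0\<close> as \<open>|\<omega>| < 1\<close>.\<close>
    define K where "K = H * \<omega>\<^sup>2"
    have "Re (H + K) = 0" "Im (H - K) = 0"
      using h unfolding frechet_derivative_at[OF der, symmetric] H_def K_def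
      by (simp_all add: vec_eq_iff forall_3 algebra_simps)
    then have "H = - cnj K" by (simp add: complex_eq_iff)
    then have "norm H = norm K" by simp
    then have "norm H = norm H * (norm \<omega>)\<^sup>2" by (simp add: K_def norm_mult norm_power)
    moreover have "(norm \<omega>)\<^sup>2 < 1" using n[OF w] by (simp add: abs_square_less_1)
    ultimately have "H = 0" by auto
    then show "h = 0" using M0[OF w] by (simp add: H_def)
  qed
  moreover have "linear (frechet_derivative X (at \<omega>))"
    unfolding frechet_derivative_at[OF der, symmetric] by (rule has_derivative_linear[OF der])
  ultimately show "inj (frechet_derivative X (at \<omega>))"
    unfolding linear_injective_0[OF \<open>linear _\<close>] by blast
  define A B C where "A = M \<omega> * (1 + \<omega>\<^sup>2)" and "B = \<i> * M \<omega> * (1 - \<omega>\<^sup>2)" and "C = 2 * M \<omega> * \<omega>"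
  have iso: "A * A + B * B - C * C = 0"
    unfolding A_def B_def C_def by (simp add: algebra_simps power2_eq_square)
  have times_i: "Re (x * \<i>) = - Im x" for x by simp
  have "pdx X \<omega> = vector [Re A, Re B, Re C]" "pdy X \<omega> = vector [- Im A, - Im B, - Im C]"
    unfolding pdx_eqI[OF der] pdy_eqI[OF der] A_def B_def C_def mult_1_right times_i by (rule refl)+
  moreover have "Re (A * A + B * B - C * C) = 0" "Im (A * A + B * B - C * C) = 0" unfolding iso by auto
  ultimately show "mink (pdx X \<omega>) (pdx X \<omega>) = mink (pdy X \<omega>) (pdy X \<omega>)" "mink (pdx X \<omega>) (pdy X \<omega>) = 0"
    unfolding mink_def by (auto simp: algebra_simps)
qed

section \<open>Spacelike surfaces as graphs\<close>

lemma smooth_on_vec_nth: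
  fixes X :: "'a::euclidean_space \<Rightarrow> real^'n"
  assumes "open U" "smooth_on X U"
  shows "smooth_on (\<lambda>w. X w $ i) U"
  by (rule smooth_on_bounded_linear[OF assms(1) bounded_linear_vec_nth assms(2)])

lemma frechet_derivative_plane_nth:
  fixes X :: "complex \<Rightarrow> real^'n"
  assumes "open U" "smooth_on X U" "w \<in> U"
  shows "frechet_derivative X (at w) h $ i = Re h * pdx (\<lambda>w. X w $ i) w + Im h * pdy (\<lambda>w. X w $ i) w"
proof -
  have "((\<lambda>w. X w $ i) has_derivative (\<lambda>h. frechet_derivative X (at w) h $ i)) (at w)"
    by (rule bounded_linear.has_derivative[OF bounded_linear_vec_nth smooth_on_has_derivative[OF assms(2,3)]])
  from has_derivative_unique[OF this smooth_on_has_derivative_pd[OF smooth_on_vec_nth[OF assms(1,2)] assms(3)]]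
  show ?thesis by (simp add: fun_eq_iff)
qed

text \<open>
  The projection of a spacelike surface to the \<open>(x, y)\<close> plane is a local diffeomorphism, because a tangent
  vector in its kernel is vertical and so cannot be spacelike.
\<close>

lemma spacelike_surface_local_graph:
  assumes "spacelike_surface S f" "p \<in> topspace S"
  obtains D c \<phi> where "local_graph S f D c \<phi>" "p \<in> c ` D"
proof -
  obtain D c where c: "local_param S f D c" "p \<in> c ` D"
    using assms unfolding spacelike_surface_def immersed_surface_def by metis
  then obtain w0 where w0: "w0 \<in> D" "p = c w0" by blast
  define X where "X = f \<circ> c"
  have D: "open D" and sX: "smooth_on X D" using c(1) by (auto simp: local_param_def X_def)
  define \<alpha> \<beta> \<gamma> where "\<alpha> = (\<lambda>w. X w $ 1)" and "\<beta> = (\<lambda>w. X w $ 2)" and "\<gamma> = (\<lambda>w. X w $ 3)"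
  have sm: "smooth_on \<alpha> D" "smooth_on \<beta> D" "smooth_on \<gamma> D"
    unfolding \<alpha>_def \<beta>_def \<gamma>_def by (rule smooth_on_vec_nth[OF D sX])+
  define Y a b where "Y = (\<lambda>w. Complex (\<alpha> w) (\<beta> w))"
    and "a = (\<lambda>w. Complex (pdx \<alpha> w) (pdx \<beta> w))" and "b = (\<lambda>w. Complex (pdy \<alpha> w) (pdy \<beta> w))"
  have Y: "has_grad Y (a w) (b w) w" if "w \<in> D" for w
    unfolding Y_def a_def b_def
    by (rule has_grad_Complex[OF smooth_on_has_derivative_pd[OF sm(1) that] smooth_on_has_derivative_pd[OF sm(2) that]])
  have inj0: "h = 0" if h: "Re h *\<^sub>R a w0 + Im h *\<^sub>R b w0 = 0" for h
  proof (rule ccontr)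
    assume "h \<noteq> 0"
    then have "mink (frechet_derivative X (at w0) h) (frechet_derivative X (at w0) h) > 0"
      using assms(1) c(1) w0(1) unfolding spacelike_surface_def X_def by blast
    moreover have "frechet_derivative X (at w0) h $ 1 = 0" "frechet_derivative X (at w0) h $ 2 = 0"
      using h unfolding frechet_derivative_plane_nth[OF D sX w0(1)] a_def b_def \<alpha>_def \<beta>_def
      by (auto simp: complex_eq_iff)
    ultimately show False by (simp add: mink_def not_less)
  qed
  have contab: "continuous_on D a" "continuous_on D b"
    unfolding a_def b_def by (intro continuous_on_Complex smooth_on_imp_continuous_on smooth_on_pd sm)+
  obtain U V m m' where U: "open U" "U \<subseteq> D" "w0 \<in> U" "open V" "homeomorphism U V Y m"
    and m': "\<And>y. y \<in> V \<Longrightarrow> (m has_derivative m' y) (at y)"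
    "\<And>y h. y \<in> V \<Longrightarrow> Re (m' y h) *\<^sub>R a (m y) + Im (m' y h) *\<^sub>R b (m y) = h"
    by (rule plane_inverse_function[OF D w0(1) Y contab inj0]) blast+
  have m'Re: "Re (m' y h) * pdx \<alpha> (m y) + Im (m' y h) * pdy \<alpha> (m y) = Re h"
    and m'Im: "Re (m' y h) * pdx \<beta> (m y) + Im (m' y h) * pdy \<beta> (m y) = Im h" if "y \<in> V" for y h
    using m'(2)[OF that, of h] by (auto simp: complex_eq_iff a_def b_def)
  have mV: "m y \<in> U" "Y (m y) = y" if "y \<in> V" for y
    using U(5) that unfolding homeomorphism_def by blast+
  have YU: "Y w \<in> V" "m (Y w) = w" if "w \<in> U" for w
    using U(5) that unfolding homeomorphism_def by blast+
  have J0: "pdx \<alpha> w * pdy \<beta> w - pdy \<alpha> w * pdx \<beta> w \<noteq> 0" if w: "w \<in> U" for w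
  proof
    assume J: "pdx \<alpha> w * pdy \<beta> w - pdy \<alpha> w * pdx \<beta> w = 0"
    \<comment> \<open>The matrix of \<open>m'\<close> is inverse to the Jacobian matrix of \<open>Y\<close>, so the product of their determinants is 1.\<close>
    define A B C E where "A = Re (m' (Y w) 1)" and "B = Im (m' (Y w) 1)" and "C = Re (m' (Y w) \<i>)" and "E = Im (m' (Y w) \<i>)"
    have "A * pdx \<alpha> w + B * pdy \<alpha> w = 1" "A * pdx \<beta> w + B * pdy \<beta> w = 0"
      "C * pdx \<alpha> w + E * pdy \<alpha> w = 0" "C * pdx \<beta> w + E * pdy \<beta> w = 1"
      using m'Re[OF YU(1)[OF w]] m'Im[OF YU(1)[OF w]] unfolding YU(2)[OF w] A_def B_def C_def E_def by auto
    then have "(A * E - B * C) * (pdx \<alpha> w * pdy \<beta> w - pdy \<alpha> w * pdx \<beta> w) = 1" by algebra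
    then show False unfolding J by simp
  qed
  define \<phi> where "\<phi> = (\<lambda>y. \<gamma> (m y))"
  have sU: "smooth_on \<alpha> U" "smooth_on \<beta> U" "smooth_on \<gamma> U" using sm U(2) smooth_on_subset by blast+
  have s\<phi>: "smooth_on \<phi> V"
    unfolding \<phi>_def by (rule smooth_on_compose_local_inverse[OF U(1,4) sU mV(1) m'(1) m'Re m'Im J0])
  define G where "G = (\<lambda>y. vector [Re y, Im y, \<phi> y] :: real^3)"
  have G: "(f \<circ> (c \<circ> m)) y = G y" if "y \<in> V" for y
  proof -
    have "f (c (m y)) $ 1 = Re (Y (m y))" "f (c (m y)) $ 2 = Im (Y (m y))" "f (c (m y)) $ 3 = \<phi> y"
      by (simp_all add: Y_def \<alpha>_def \<beta>_def X_def \<phi>_def \<gamma>_def)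
    then show ?thesis unfolding mV(2)[OF that] by (simp add: G_def vec_eq_iff forall_3)
  qed
  have "smooth_on (\<lambda>y. Re y) V" "smooth_on (\<lambda>y. Im y) V"
    using smooth_on_Re_holomorphic[OF U(4), of "\<lambda>y. y"] smooth_on_Re_holomorphic[OF U(4), of "\<lambda>y. - \<i> * y"]
    by (auto intro!: holomorphic_intros)
  then have sG: "smooth_on G V" unfolding G_def by (intro smooth_on_vector3 U(4) s\<phi>)
  have sfc: "smooth_on (f \<circ> (c \<circ> m)) V" by (rule smooth_on_cong[OF U(4) _ sG]) (rule G[symmetric])
  have der: "frechet_derivative (f \<circ> (c \<circ> m)) (at y) = (\<lambda>h. vector [Re h, Im h, Re h * pdx \<phi> y + Im h * pdy \<phi> y])"
    if y: "y \<in> V" for y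
  proof -
    have "(G has_derivative (\<lambda>h. vector [Re h, Im h, Re h *\<^sub>R pdx \<phi> y + Im h *\<^sub>R pdy \<phi> y])) (at y)"
      unfolding G_def
      by (intro has_derivative_vector3 smooth_on_has_derivative_pd[OF s\<phi> y])
        (auto intro!: bounded_linear_imp_has_derivative bounded_linear_Re bounded_linear_Im)
    then have "(f \<circ> (c \<circ> m) has_derivative (\<lambda>h. vector [Re h, Im h, Re h *\<^sub>R pdx \<phi> y + Im h *\<^sub>R pdy \<phi> y])) (at y)"
      by (rule has_derivative_transform_within_open[OF _ U(4) y]) (rule G[symmetric])
    from frechet_derivative_at[OF this] show ?thesis by simp
  qed
  have param: "local_param S f V (c \<circ> m)"
  proof (rule local_param_reparam[OF c(1) U(5,1,2,4) sfc])
    show "inj (frechet_derivative (f \<circ> (c \<circ> m)) (at w))" if "w \<in> V" for w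
      unfolding der[OF that] by (rule injI) (simp add: vec_eq_iff forall_3 complex_eq_iff)
  qed
  have "(pdx \<phi> y)\<^sup>2 + (pdy \<phi> y)\<^sup>2 < 1" if y: "y \<in> V" for y
  proof (cases "pdx \<phi> y = 0 \<and> pdy \<phi> y = 0")
    case False
    define N where "N = (pdx \<phi> y)\<^sup>2 + (pdy \<phi> y)\<^sup>2"
    \<comment> \<open>The direction of steepest ascent is the one in which spacelikeness bounds the slope.\<close>
    define h where "h = Complex (pdx \<phi> y) (pdy \<phi> y)"
    have "N > 0" using False unfolding N_def by (simp add: sum_power2_gt_zero_iff)
    have "h \<noteq> 0" using False by (simp add: h_def complex_eq_iff)
    then have "mink (frechet_derivative (f \<circ> (c \<circ> m)) (at y) h) (frechet_derivative (f \<circ> (c \<circ> m)) (at y) h) > 0"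
      using assms(1) param y unfolding spacelike_surface_def by blast
    then have "N - N * N > 0" unfolding der[OF y] by (simp add: mink_def h_def N_def power2_eq_square)
    then have "N * (1 - N) > 0" by (simp add: algebra_simps)
    then show ?thesis using \<open>N > 0\<close> by (simp add: zero_less_mult_iff N_def)
  qed simp
  then have "local_graph S f V (c \<circ> m) \<phi>"
    unfolding local_graph_def using param s\<phi> G by (simp add: G_def)
  moreover have "p \<in> (c \<circ> m) ` V" using YU[OF U(3)] w0(2) by force
  ultimately show ?thesis by (rule that)
qed

text \<open>
  Rationalization: \<open>(1 - W) / (p - i q) = (p + i q) / (1 + W)\<close> because \<open>1 - W\<^sup>2 = p\<^sup>2 + q\<^sup>2\<close>.
\<close>

lemma zeta_eq_slope_zeta:
  assumes "(pdx \<phi> z)\<^sup>2 + (pdy \<phi> z)\<^sup>2 < 1"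
  shows "zeta \<phi> z = slope_zeta (pdx \<phi> z) (pdy \<phi> z)"
proof -
  define p q W where "p = pdx \<phi> z" and "q = pdy \<phi> z" and "W = area_density p q"
  have W: "W > 0" "W\<^sup>2 = 1 - p\<^sup>2 - q\<^sup>2" using area_density_props assms by (auto simp: p_def q_def W_def)
  have z: "slope_zeta p q = Complex p q / of_real (1 + W)" by (simp add: slope_zeta_def W_def complex_eq_iff)
  have u: "dzbar \<phi> z = Complex p q / 2" "dz \<phi> z = Complex p (- q) / 2"
    by (simp_all add: dzbar_def dz_def Complex_eq p_def q_def)
  have "1 - 4 * dzbar \<phi> z * dz \<phi> z = of_real (W\<^sup>2)"
    unfolding u W(2) by (simp add: complex_eq_iff power2_eq_square)
  then have s: "csqrt (1 - 4 * dzbar \<phi> z * dz \<phi> z) = of_real W" using W(1) by (simp add: csqrt_unique)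
  show ?thesis
  proof (cases "dz \<phi> z = 0")
    case True
    then have "p = 0" "q = 0" unfolding u by (auto simp: complex_eq_iff)
    then show ?thesis using True by (simp add: zeta_def slope_zeta_def complex_eq_iff flip: p_def q_def)
  next
    case False
    have W1: "(1 + of_real W :: complex) \<noteq> 0" using W(1) by (simp add: complex_eq_iff)
    have "(1 - of_real W) * (1 + of_real W) = Complex p q * Complex p (- q)"
      using W(2) by (simp add: complex_eq_iff power2_eq_square algebra_simps)
    then have "(1 - of_real W) / Complex p (- q) = Complex p q / (1 + of_real W)"
      using False W1 unfolding u by (simp add: field_simps)
    then have "zeta \<phi> z = Complex p q / (1 + of_real W)"
      using False s unfolding zeta_def Let_def u(2) by simp
    then show ?thesis using z by (simp add: p_def q_def)
  qed
qed

text \<open>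
  \<open>1 + |\<zeta>|\<^sup>2 = 2 / (1 + W)\<close>, so \<open>\<zeta>\<close> determines \<open>W\<close>, and then the slope.
\<close>

lemma slope_zeta_inject:
  assumes "p\<^sup>2 + q\<^sup>2 < 1" "p'\<^sup>2 + q'\<^sup>2 < 1" "slope_zeta p q = slope_zeta p' q'"
  shows "p = p'" "q = q'"
proof -
  have n: "1 + (norm (slope_zeta p q))\<^sup>2 = 2 / (1 + area_density p q)" if "p\<^sup>2 + q\<^sup>2 < 1" for p q
  proof -
    define W where "W = area_density p q"
    have W: "W > 0" "W\<^sup>2 = 1 - p\<^sup>2 - q\<^sup>2" using area_density_props[OF that] by (auto simp: W_def)
    have "(norm (slope_zeta p q))\<^sup>2 = (p\<^sup>2 + q\<^sup>2) / (1 + W)\<^sup>2"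
      unfolding slope_zeta_def W_def by (simp add: cmod_power2 power_divide add_divide_distrib)
    also have "p\<^sup>2 + q\<^sup>2 = 1 - W\<^sup>2" using W by simp
    also have "(1 - W\<^sup>2) / (1 + W)\<^sup>2 = (1 - W) * (1 + W) / ((1 + W) * (1 + W))"
      by (simp add: power2_eq_square algebra_simps)
    also have "\<dots> = (1 - W) / (1 + W)" using W(1) by simp
    finally show ?thesis unfolding W_def[symmetric] using W(1) by (simp add: field_simps)
  qed
  have W: "area_density p q > 0" "area_density p' q' > 0" using area_density_props assms by auto
  have "area_density p q = area_density p' q'" using n[OF assms(1)] n[OF assms(2)] W unfolding assms(3) by (simp add: field_simps)
  with assms(3) W show "p = p'" "q = q'" by (auto simp: slope_zeta_def)
qed

section \<open>Maximal graphs and the Gauss map\<close>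

lemma local_graph_partials:
  assumes "local_graph S f D c \<phi>" "z \<in> D"
  shows "frechet_derivative (f \<circ> c) (at z) = (\<lambda>h. vector [Re h, Im h, Re h * pdx \<phi> z + Im h * pdy \<phi> z])"
    and "pdx (pdx (f \<circ> c)) z = vector [0, 0, pdx (pdx \<phi>) z]"
    and "pdx (pdy (f \<circ> c)) z = vector [0, 0, pdx (pdy \<phi>) z]"
    and "pdy (pdy (f \<circ> c)) z = vector [0, 0, pdy (pdy \<phi>) z]"
proof -
  have D: "open D" and s: "smooth_on \<phi> D" and X: "\<And>z. z \<in> D \<Longrightarrow> f (c z) = vector [Re z, Im z, \<phi> z]"
    using assms(1) by (auto simp: local_graph_def local_param_def)
  have der: "(f \<circ> c has_derivative (\<lambda>h. vector [Re h, Im h, Re h * pdx \<phi> z + Im h * pdy \<phi> z])) (at z)" if z: "z \<in> D" for z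
  proof -
    have "((\<lambda>z. vector [Re z, Im z, \<phi> z] :: real^3) has_derivative (\<lambda>h. vector [Re h, Im h, Re h *\<^sub>R pdx \<phi> z + Im h *\<^sub>R pdy \<phi> z])) (at z)"
      by (intro has_derivative_vector3 smooth_on_has_derivative_pd[OF s z])
        (auto intro!: bounded_linear_imp_has_derivative bounded_linear_Re bounded_linear_Im)
    then have "(f \<circ> c has_derivative (\<lambda>h. vector [Re h, Im h, Re h *\<^sub>R pdx \<phi> z + Im h *\<^sub>R pdy \<phi> z])) (at z)"
      by (rule has_derivative_transform_within_open[OF _ D z]) (simp add: X)
    then show ?thesis by simp
  qed
  show "frechet_derivative (f \<circ> c) (at z) = (\<lambda>h. vector [Re h, Im h, Re h * pdx \<phi> z + Im h * pdy \<phi> z])"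
    using frechet_derivative_at[OF der[OF assms(2)]] by simp
  have second: "(X has_derivative (\<lambda>h. vector [0, 0, Re h *\<^sub>R pdx \<psi> z + Im h *\<^sub>R pdy \<psi> z])) (at z)"
    if "smooth_on \<psi> D" "\<And>w. w \<in> D \<Longrightarrow> X w = vector [x, y, \<psi> w]" for x y \<psi> and X :: "complex \<Rightarrow> real^3"
  proof -
    have "((\<lambda>z. vector [x, y, \<psi> z] :: real^3) has_derivative (\<lambda>h. vector [0, 0, Re h *\<^sub>R pdx \<psi> z + Im h *\<^sub>R pdy \<psi> z])) (at z)"
      by (intro has_derivative_vector3 smooth_on_has_derivative_pd[OF that(1) assms(2)] has_derivative_const)
    then show ?thesis
      by (rule has_derivative_transform_within_open[OF _ D assms(2)]) (simp add: that(2))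
  qed
  have px: "pdx (f \<circ> c) w = vector [1, 0, pdx \<phi> w]" and py: "pdy (f \<circ> c) w = vector [0, 1, pdy \<phi> w]" if "w \<in> D" for w
    using pdx_eqI[OF der[OF that]] pdy_eqI[OF der[OF that]] by simp_all
  show "pdx (pdx (f \<circ> c)) z = vector [0, 0, pdx (pdx \<phi>) z]"
    using pdx_eqI[OF second[OF smooth_on_pd(1)[OF s] px]] by simp
  show "pdx (pdy (f \<circ> c)) z = vector [0, 0, pdx (pdy \<phi>) z]"
    using pdx_eqI[OF second[OF smooth_on_pd(2)[OF s] py]] by simp
  show "pdy (pdy (f \<circ> c)) z = vector [0, 0, pdy (pdy \<phi>) z]"
    using pdy_eqI[OF second[OF smooth_on_pd(2)[OF s] py]] by simp
qed

lemma smooth_on_mixed_partials: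
  fixes \<phi> :: "complex \<Rightarrow> real"
  assumes "open D" "smooth_on \<phi> D" "z \<in> D"
  shows "pdx (pdy \<phi>) z = pdy (pdx \<phi>) z"
proof -
  note sm = smooth_on_pd[OF assms(2)]
  have "(\<lambda>h. Re h *\<^sub>R pdx (pdx \<phi>) z + Im h *\<^sub>R pdy (pdx \<phi>) z) \<i> = (\<lambda>h. Re h *\<^sub>R pdx (pdy \<phi>) z + Im h *\<^sub>R pdy (pdy \<phi>) z) 1"
  proof (rule mixed_partials_symmetric[OF assms(1,3), of \<phi> "\<lambda>z h. Re h *\<^sub>R pdx \<phi> z + Im h *\<^sub>R pdy \<phi> z" 1
      "\<lambda>z h. Re h *\<^sub>R pdx (pdx \<phi>) z + Im h *\<^sub>R pdy (pdx \<phi>) z" \<i> "\<lambda>z h. Re h *\<^sub>R pdx (pdy \<phi>) z + Im h *\<^sub>R pdy (pdy \<phi>) z"])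
    show "has_grad \<phi> (pdx \<phi> w) (pdy \<phi> w) w" if "w \<in> D" for w
      by (rule smooth_on_has_derivative_pd[OF assms(2) that])
  next
    fix w assume w: "w \<in> D"
    show "has_grad (\<lambda>w. Re 1 *\<^sub>R pdx \<phi> w + Im 1 *\<^sub>R pdy \<phi> w) (pdx (pdx \<phi>) w) (pdy (pdx \<phi>) w) w"
      using smooth_on_has_derivative_pd[OF sm(1) w] by simp
    show "has_grad (\<lambda>w. Re \<i> *\<^sub>R pdx \<phi> w + Im \<i> *\<^sub>R pdy \<phi> w) (pdx (pdy \<phi>) w) (pdy (pdy \<phi>) w) w"
      using smooth_on_has_derivative_pd[OF sm(2) w] by simp
  next
    show "continuous_on D (\<lambda>w. Re \<i> *\<^sub>R pdx (pdx \<phi>) w + Im \<i> *\<^sub>R pdy (pdx \<phi>) w)"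
      "continuous_on D (\<lambda>w. Re 1 *\<^sub>R pdx (pdy \<phi>) w + Im 1 *\<^sub>R pdy (pdy \<phi>) w)"
      using smooth_on_imp_continuous_on[OF smooth_on_pd(2)[OF sm(1)]] smooth_on_imp_continuous_on[OF smooth_on_pd(1)[OF sm(2)]]
      by simp_all
  qed
  then show ?thesis by simp
qed

text \<open>
  A unit normal of a graph is \<open>\<plusminus> (p, q, 1) / W\<close>.
\<close>

lemma unit_normal_graph:
  fixes n :: "real^3"
  assumes "local_graph S f D c \<phi>" "z \<in> D" "unit_normal (f \<circ> c) z n"
  shows "n $ 1 = pdx \<phi> z * n $ 3" "n $ 2 = pdy \<phi> z * n $ 3"
    "(n $ 3)\<^sup>2 * (1 - (pdx \<phi> z)\<^sup>2 - (pdy \<phi> z)\<^sup>2) = 1"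
proof -
  have n: "mink n n = -1" "mink n (vector [Re h, Im h, Re h * pdx \<phi> z + Im h * pdy \<phi> z]) = 0" for h
    using assms(3) unfolding unit_normal_def local_graph_partials(1)[OF assms(1,2)] by blast+
  show 1: "n $ 1 = pdx \<phi> z * n $ 3" "n $ 2 = pdy \<phi> z * n $ 3"
    using n(2)[of 1] n(2)[of \<i>] by (simp_all add: mink_def)
  show "(n $ 3)\<^sup>2 * (1 - (pdx \<phi> z)\<^sup>2 - (pdy \<phi> z)\<^sup>2) = 1"
    using n(1) unfolding mink_def 1 by (simp add: algebra_simps power2_eq_square)
qed

lemma maximal_graph_equation:
  assumes "maximal_surface S f" "local_graph S f D c \<phi>" "z \<in> D" "unit_normal (f \<circ> c) z n"
  shows "(1 - (pdy \<phi> z)\<^sup>2) * pdx (pdx \<phi>) z + 2 * pdx \<phi> z * pdy \<phi> z * pdy (pdx \<phi>) z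
    + (1 - (pdx \<phi> z)\<^sup>2) * pdy (pdy \<phi>) z = 0"
proof -
  have lp: "local_param S f D c" and pq: "(pdx \<phi> z)\<^sup>2 + (pdy \<phi> z)\<^sup>2 < 1" and D: "open D" "smooth_on \<phi> D"
    using assms(2,3) by (auto simp: local_graph_def local_param_def)
  define p q r s t where "p = pdx \<phi> z" and "q = pdy \<phi> z" and "r = pdx (pdx \<phi>) z" and "s = pdy (pdx \<phi>) z" and "t = pdy (pdy \<phi>) z"
  note n = unit_normal_graph[OF assms(2-4), folded p_def q_def]
  have X: "pdx (f \<circ> c) z = vector [1, 0, p]" "pdy (f \<circ> c) z = vector [0, 1, q]"
    "pdx (pdx (f \<circ> c)) z = vector [0, 0, r]" "pdx (pdy (f \<circ> c)) z = vector [0, 0, s]" "pdy (pdy (f \<circ> c)) z = vector [0, 0, t]"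
    using local_graph_partials[OF assms(2,3)] smooth_on_mixed_partials[OF D assms(3)]
    by (simp_all add: pdx_def[of "f \<circ> c" z] pdy_def[of "f \<circ> c" z] p_def q_def r_def s_def t_def)
  have "mean_curvature (f \<circ> c) n z = 0"
    using assms(1,3,4) lp unfolding maximal_surface_def by blast
  moreover have "(1 - p * p) * (1 - q * q) - (p * q)\<^sup>2 \<noteq> 0"
    using pq unfolding p_def[symmetric] q_def[symmetric] by (simp add: algebra_simps power2_eq_square)
  ultimately have "n $ 3 * ((1 - q\<^sup>2) * r + 2 * p * q * s + (1 - p\<^sup>2) * t) = 0"
    unfolding mean_curvature_def X by (simp add: mink_def Let_def power2_eq_square algebra_simps)
  moreover have "n $ 3 \<noteq> 0" using n(3) by auto
  ultimately show ?thesis by (simp add: p_def q_def r_def s_def t_def)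
qed

text \<open>
  \<open>\<zeta>\<close> determines the slope, hence the unit normal up to sign; the Gauss map is continuous, so near
  \<open>z0\<close> the sign does not change and \<open>\<zeta>\<close> determines the normal.
\<close>

lemma graph_zeta_locally_injective:
  assumes N: "gauss_map S f N" "inj_on N (topspace S)"
    and gr: "local_graph S f D c \<phi>" and z0: "z0 \<in> D"
  obtains D1 where "open D1" "z0 \<in> D1" "D1 \<subseteq> D" "inj_on (\<lambda>z. slope_zeta (pdx \<phi> z) (pdy \<phi> z)) D1"
proof -
  have lp: "local_param S f D c" and pq: "\<And>z. z \<in> D \<Longrightarrow> (pdx \<phi> z)\<^sup>2 + (pdy \<phi> z)\<^sup>2 < 1"
    using gr by (auto simp: local_graph_def)
  then have D: "open D" and emb: "embedding_map (top_of_set D) S c" by (auto simp: local_param_def)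
  have cc: "continuous_map (top_of_set D) S c" and cinj: "inj_on c D"
    using emb unfolding embedding_map_def
    by (auto dest: homeomorphic_imp_continuous_map homeomorphic_imp_injective_map simp: continuous_map_in_subtopology)
  have cS: "c z \<in> topspace S" if "z \<in> D" for z
    using continuous_map_image_subset_topspace[OF cc] that by auto
  have "continuous_map (top_of_set D) euclidean (N \<circ> c)"
    using cc N(1) unfolding gauss_map_def by (meson continuous_map_compose)
  then have contN: "continuous_on D (\<lambda>z. N (c z) $ 3)"
    by (intro continuous_on_component) (simp add: o_def)
  have un: "unit_normal (f \<circ> c) z (N (c z))" if "z \<in> D" for z
    using N(1) lp that unfolding gauss_map_def by blast
  note nn = unit_normal_graph[OF gr _ un]
  define D1 where "D1 = D \<inter> (\<lambda>z. N (c z) $ 3 * N (c z0) $ 3) -` {0<..}"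
  have "open D1" unfolding D1_def
    by (intro continuous_open_preimage D) (auto intro!: continuous_intros contN)
  moreover have "N (c z0) $ 3 \<noteq> 0" using nn(3)[OF z0 z0] by auto
  then have "z0 \<in> D1" using z0 unfolding D1_def by (auto simp: zero_less_mult_iff linorder_neq_iff)
  moreover have "inj_on (\<lambda>z. slope_zeta (pdx \<phi> z) (pdy \<phi> z)) D1"
  proof (rule inj_onI)
    fix z z' assume z: "z \<in> D1" "z' \<in> D1" and eq: "slope_zeta (pdx \<phi> z) (pdy \<phi> z) = slope_zeta (pdx \<phi> z') (pdy \<phi> z')"
    then have zD: "z \<in> D" "z' \<in> D" by (auto simp: D1_def)
    have e: "pdx \<phi> z = pdx \<phi> z'" "pdy \<phi> z = pdy \<phi> z'" using slope_zeta_inject[OF pq[OF zD(1)] pq[OF zD(2)] eq] by auto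
    have K: "1 - (pdx \<phi> z')\<^sup>2 - (pdy \<phi> z')\<^sup>2 \<noteq> 0" using pq[OF zD(2)] by simp
    have "(N (c z) $ 3)\<^sup>2 * (1 - (pdx \<phi> z')\<^sup>2 - (pdy \<phi> z')\<^sup>2) = (N (c z') $ 3)\<^sup>2 * (1 - (pdx \<phi> z')\<^sup>2 - (pdy \<phi> z')\<^sup>2)"
      using nn(3)[OF zD(1) zD(1)] nn(3)[OF zD(2) zD(2)] unfolding e by (rule trans[OF _ sym])
    then have "(N (c z) $ 3)\<^sup>2 = (N (c z') $ 3)\<^sup>2"
      using K by (rule mult_right_cancel[THEN iffD1, rotated])
    then consider "N (c z) $ 3 = N (c z') $ 3" | "N (c z) $ 3 = - N (c z') $ 3" unfolding power2_eq_iff by blast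
    then have "N (c z) $ 3 = N (c z') $ 3"
    proof cases
      case 2
      have "N (c z) $ 3 * N (c z0) $ 3 > 0" "N (c z') $ 3 * N (c z0) $ 3 > 0" using z by (auto simp: D1_def)
      then show ?thesis unfolding 2 by simp
    qed
    then have "N (c z) = N (c z')"
      using nn(1,2)[OF zD(1) zD(1)] nn(1,2)[OF zD(2) zD(2)] e by (simp add: vec_eq_iff forall_3)
    then have "c z = c z'" using N(2) cS zD by (auto dest: inj_onD)
    then show "z = z'" using cinj zD by (auto dest: inj_onD)
  qed
  ultimately show ?thesis using that[of D1] by (auto simp: D1_def)
qed

section \<open>The representation theorem\<close>

theorem theorem2p2:
  fixes S :: "'a topology" and f N :: "'a \<Rightarrow> real^3" and p :: 'a
  assumes "maximal_surface S f"
    and "gauss_map S f N"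
    and "inj_on N (topspace S)"
    and "p \<in> topspace S"
  shows "(\<exists>D c \<phi>. local_graph S f D c \<phi> \<and> p \<in> c ` D) \<and>
    (\<forall>D c \<phi> z0. local_graph S f D c \<phi> \<and> z0 \<in> D \<and> c z0 = p \<longrightarrow>
      (\<exists>D' V g. open D' \<and> z0 \<in> D' \<and> D' \<subseteq> D \<and>
        homeomorphism D' V (zeta \<phi>) g \<and>
        complex_param S f V (c \<circ> g) \<and>
        (\<exists>(x0::real) (y0::real) (\<phi>0::real) M F1 F2 F3.
          M meromorphic_on V \<and>
          (\<forall>\<omega>\<in>V.
            (F1 has_field_derivative M \<omega> * (1 + \<omega>\<^sup>2)) (at \<omega>) \<and>
            (F2 has_field_derivative \<i> * M \<omega> * (1 - \<omega>\<^sup>2)) (at \<omega>) \<and>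
            (F3 has_field_derivative 2 * M \<omega> * \<omega>) (at \<omega>)) \<and>
          (\<forall>\<zeta>\<in>V.
            f (c (g \<zeta>)) $ 1 = x0 + Re (F1 \<zeta>) \<and>
            f (c (g \<zeta>)) $ 2 = y0 + Re (F2 \<zeta>) \<and>
            f (c (g \<zeta>)) $ 3 = \<phi>0 + Re (F3 \<zeta>)))))"
proof (intro conjI allI impI)
  have "spacelike_surface S f" using assms(1) by (simp add: maximal_surface_def)
  then show "\<exists>D c \<phi>. local_graph S f D c \<phi> \<and> p \<in> c ` D"
    using spacelike_surface_local_graph assms(4) by metis
next
  fix D c \<phi> z0
  assume "local_graph S f D c \<phi> \<and> z0 \<in> D \<and> c z0 = p"
  then have gr: "local_graph S f D c \<phi>" and z0: "z0 \<in> D" by auto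
  then have lp: "local_param S f D c" and D: "open D" and s\<phi>: "smooth_on \<phi> D"
    and pq: "\<And>z. z \<in> D \<Longrightarrow> (pdx \<phi> z)\<^sup>2 + (pdy \<phi> z)\<^sup>2 < 1"
    and fc: "\<And>z. z \<in> D \<Longrightarrow> f (c z) = vector [Re z, Im z, \<phi> z]"
    by (auto simp: local_graph_def local_param_def)
  define Z where "Z = (\<lambda>z. slope_zeta (pdx \<phi> z) (pdy \<phi> z))"
  obtain D1 where D1: "open D1" "z0 \<in> D1" "D1 \<subseteq> D" "inj_on Z D1"
    using graph_zeta_locally_injective[OF assms(2,3) gr z0] unfolding Z_def by metis
  note sp = smooth_on_pd[OF s\<phi>]
  have g\<phi>: "has_grad \<phi> (pdx \<phi> z) (pdy \<phi> z) z"
    and gp: "has_grad (pdx \<phi>) (pdx (pdx \<phi>) z) (pdy (pdx \<phi>) z) z"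
    and gq: "has_grad (pdy \<phi>) (pdy (pdx \<phi>) z) (pdy (pdy \<phi>) z) z"
    and pq1: "(pdx \<phi> z)\<^sup>2 + (pdy \<phi> z)\<^sup>2 < 1"
    and mx: "(1 - (pdy \<phi> z)\<^sup>2) * pdx (pdx \<phi>) z + 2 * pdx \<phi> z * pdy \<phi> z * pdy (pdx \<phi>) z
      + (1 - (pdx \<phi> z)\<^sup>2) * pdy (pdy \<phi>) z = 0" if "z \<in> D1" for z
  proof -
    have z: "z \<in> D" using that D1(3) by blast
    show "has_grad \<phi> (pdx \<phi> z) (pdy \<phi> z) z" by (rule smooth_on_has_derivative_pd[OF s\<phi> z])
    show "has_grad (pdx \<phi>) (pdx (pdx \<phi>) z) (pdy (pdx \<phi>) z) z" by (rule smooth_on_has_derivative_pd[OF sp(1) z])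
    show "has_grad (pdy \<phi>) (pdy (pdx \<phi>) z) (pdy (pdy \<phi>) z) z"
      using smooth_on_has_derivative_pd[OF sp(2) z] unfolding smooth_on_mixed_partials[OF D s\<phi> z] .
    show "(pdx \<phi> z)\<^sup>2 + (pdy \<phi> z)\<^sup>2 < 1" by (rule pq[OF z])
    have "unit_normal (f \<circ> c) z (N (c z))"
      using assms(2) lp z unfolding gauss_map_def by blast
    then show "(1 - (pdy \<phi> z)\<^sup>2) * pdx (pdx \<phi>) z + 2 * pdx \<phi> z * pdy \<phi> z * pdy (pdx \<phi>) z
      + (1 - (pdx \<phi> z)\<^sup>2) * pdy (pdy \<phi>) z = 0"
      by (rule maximal_graph_equation[OF assms(1) gr z])
  qed
  note cont = smooth_on_imp_continuous_on[OF smooth_on_subset[OF smooth_on_pd(1)[OF sp(1)] D1(3)]]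
    smooth_on_imp_continuous_on[OF smooth_on_subset[OF smooth_on_pd(2)[OF sp(1)] D1(3)]]
    smooth_on_imp_continuous_on[OF smooth_on_subset[OF smooth_on_pd(2)[OF sp(2)] D1(3)]]
  obtain D' \<epsilon> g M F1 F2 F3 x0 y0 c0 where
    D': "open D'" "z0 \<in> D'" "D' \<subseteq> D1" "homeomorphism D' (ball (Z z0) \<epsilon>) Z g"
    and M: "M holomorphic_on ball (Z z0) \<epsilon>" "\<And>\<omega>. \<omega> \<in> ball (Z z0) \<epsilon> \<Longrightarrow> M \<omega> \<noteq> 0"
    and nrm: "\<And>\<omega>. \<omega> \<in> ball (Z z0) \<epsilon> \<Longrightarrow> norm \<omega> < 1"
    and F: "\<And>\<omega>. \<omega> \<in> ball (Z z0) \<epsilon> \<Longrightarrow> (F1 has_field_derivative M \<omega> * (1 + \<omega>\<^sup>2)) (at \<omega>)"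
    "\<And>\<omega>. \<omega> \<in> ball (Z z0) \<epsilon> \<Longrightarrow> (F2 has_field_derivative \<i> * M \<omega> * (1 - \<omega>\<^sup>2)) (at \<omega>)"
    "\<And>\<omega>. \<omega> \<in> ball (Z z0) \<epsilon> \<Longrightarrow> (F3 has_field_derivative 2 * M \<omega> * \<omega>) (at \<omega>)"
    and eqs: "\<And>\<omega>. \<omega> \<in> ball (Z z0) \<epsilon> \<Longrightarrow> Re (g \<omega>) = x0 + Re (F1 \<omega>)"
    "\<And>\<omega>. \<omega> \<in> ball (Z z0) \<epsilon> \<Longrightarrow> Im (g \<omega>) = y0 + Re (F2 \<omega>)"
    "\<And>\<omega>. \<omega> \<in> ball (Z z0) \<epsilon> \<Longrightarrow> \<phi> (g \<omega>) = c0 + Re (F3 \<omega>)"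
    unfolding Z_def
    by (rule weierstrass_data_of_graph[OF D1(1,2) g\<phi> gp gq cont pq1 mx D1(4)[unfolded Z_def]]) blast+
  define V where "V = ball (Z z0) \<epsilon>"
  have V: "open V" by (simp add: V_def)
  have D'D: "D' \<subseteq> D" using D'(3) D1(3) by blast
  have homeo: "homeomorphism D' V (zeta \<phi>) g"
    using D'(4)[folded V_def] by (rule homeomorphism_cong) (use D'D pq in \<open>auto simp: Z_def zeta_eq_slope_zeta\<close>)
  have gD: "g \<omega> \<in> D" if "\<omega> \<in> V" for \<omega>
    using homeo that D'D unfolding homeomorphism_def by blast
  define X where "X = f \<circ> (c \<circ> g)"
  have X: "X \<omega> = vector [x0 + Re (F1 \<omega>), y0 + Re (F2 \<omega>), c0 + Re (F3 \<omega>)]" if "\<omega> \<in> V" for \<omega>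
    using fc[OF gD[OF that]] eqs that by (simp add: X_def V_def)
  note curve = isotropic_curve_immersion[OF V M(2)[folded V_def] nrm[folded V_def] F[folded V_def] X]
  have "local_param S f V (c \<circ> g)"
    using local_param_reparam[OF lp homeo D'(1) D'D V] curve(1,2) unfolding X_def by blast
  then have param: "complex_param S f V (c \<circ> g)"
    using curve(3,4) unfolding complex_param_def X_def by blast
  have "M meromorphic_on V"
    using M(1) V unfolding V_def by (intro analytic_on_imp_meromorphic_on) (simp add: analytic_on_open)
  then have repr: "\<exists>(x0::real) (y0::real) (\<phi>0::real) M F1 F2 F3.
          M meromorphic_on V \<and>
          (\<forall>\<omega>\<in>V.
            (F1 has_field_derivative M \<omega> * (1 + \<omega>\<^sup>2)) (at \<omega>) \<and>
            (F2 has_field_derivative \<i> * M \<omega> * (1 - \<omega>\<^sup>2)) (at \<omega>) \<and>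
            (F3 has_field_derivative 2 * M \<omega> * \<omega>) (at \<omega>)) \<and>
          (\<forall>\<zeta>\<in>V.
            f (c (g \<zeta>)) $ 1 = x0 + Re (F1 \<zeta>) \<and>
            f (c (g \<zeta>)) $ 2 = y0 + Re (F2 \<zeta>) \<and>
            f (c (g \<zeta>)) $ 3 = \<phi>0 + Re (F3 \<zeta>))"
    using F[folded V_def] X
    by - (rule exI[of _ x0], rule exI[of _ y0], rule exI[of _ c0], rule exI[of _ M],
        rule exI[of _ F1], rule exI[of _ F2], rule exI[of _ F3],
        simp add: X_def)
  show "\<exists>D' V g. open D' \<and> z0 \<in> D' \<and> D' \<subseteq> D \<and>
        homeomorphism D' V (zeta \<phi>) g \<and>
        complex_param S f V (c \<circ> g) \<and>
        (\<exists>(x0::real) (y0::real) (\<phi>0::real) M F1 F2 F3.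
          M meromorphic_on V \<and>
          (\<forall>\<omega>\<in>V.
            (F1 has_field_derivative M \<omega> * (1 + \<omega>\<^sup>2)) (at \<omega>) \<and>
            (F2 has_field_derivative \<i> * M \<omega> * (1 - \<omega>\<^sup>2)) (at \<omega>) \<and>
            (F3 has_field_derivative 2 * M \<omega> * \<omega>) (at \<omega>)) \<and>
          (\<forall>\<zeta>\<in>V.
            f (c (g \<zeta>)) $ 1 = x0 + Re (F1 \<zeta>) \<and>
            f (c (g \<zeta>)) $ 2 = y0 + Re (F2 \<zeta>) \<and>
            f (c (g \<zeta>)) $ 3 = \<phi>0 + Re (F3 \<zeta>)))"
    by (rule exI[of _ D'], rule exI[of _ V], rule exI[of _ g], intro conjI D'(1,2) D'D homeo param repr)
qed

end
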